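(* Let $I\subseteq\mathbb R$ be an interval and $\gamma:I\to\mathbb H$ injective such that for all $s,t\in I$ $$[\gamma_s^{-1}\gamma_t]^{\mathsf h}\le\sqrt{|t-s|\,\omega(|t-s|)}\quad\text{and}\quad\Big|(\gamma_s^{-1}\gamma_t)^{\mathsf v}-\int_s^t\vartheta(\tau)\,d\tau\Big|\le|t-s|\,\omega(|t-s|),$$ where $\vartheta:I\to\mathbb R$ is continuous and $\omega:[0,\infty)\to[0,\infty)$ is non-decreasing with $\omega(0^+)=0$. Then for every Borel $U\subseteq\mathbb H$ and every bounded Borel $u:\mathbb H\to\mathbb R$, $$\mathcal S^2_{\mathsf d}(\gamma(I)\cap U)=\gamma_\sharp(|\vartheta|\mathcal L^1\llcorner I)(U)\quad\text{and}\quad\int_{\gamma(I)}u\,d\mathcal S^2_{\mathsf d}=\int_Iu(\gamma_\tau)|\vartheta(\tau)|\,d\tau.$$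
   Context: The Heisenberg group $\mathbb H$ is $\mathbb R^3$ with product $(x^1,x^2,x^3)(y^1,y^2,y^3)=(x^1+y^1,x^2+y^2,x^3+y^3+x^1y^2-x^2y^1)$, inverse $x^{-1}=-x$. For $x\in\mathbb H$: $x^{\mathsf h}=(x^1,x^2)$, $x^{\mathsf v}=x^3$, $[x]^{\mathsf h}=|x^{\mathsf h}|$. $\mathsf d$ is a fixed distance on $\mathbb H$, left-invariant and $1$-homogeneous w.r.t. dilations $\delta_r(x)=(rx^1,rx^2,r^2x^3)$; $B(x,r)$ is the open $\mathsf d$-ball. Spherical Hausdorff measure: $\beta_{\mathsf d}:=\sup_{\mathsf d(0,y)\le1}\mathcal L^1(\{\sigma\in\mathbb R:(0,0,\sigma)\in B(y,1)\})$; for $\varepsilon>0$, $\mathcal S^2_{\mathsf d,\varepsilon}(U):=\inf\{\sum_i\beta_{\mathsf d}r_i^2: U\subseteq\bigcup_iB(p_i,r_i),\ r_i\le\varepsilon\}$, and $\mathcal S^2_{\mathsf d}(U):=\lim_{\varepsilon\to0^+}\mathcal S^2_{\mathsf d,\varepsilon}(U)$. $\gamma_\sharp\mu$ is the push-forward measure, $\mathcal L^1\llcorner I$ Lebesgue measure restricted to $I$. *)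

theory Defs
  imports "HOL-Analysis.Analysis"
begin

type_synonym heis = "real \<times> real \<times> real"

definition hmul :: "heis \<Rightarrow> heis \<Rightarrow> heis" where
  "hmul x y = (case x of (x1, x2, x3) \<Rightarrow> case y of (y1, y2, y3) \<Rightarrow>
     (x1 + y1, x2 + y2, x3 + y3 + x1 * y2 - x2 * y1))"

definition hinv :: "heis \<Rightarrow> heis" where
  "hinv x = - x"

definition hdil :: "real \<Rightarrow> heis \<Rightarrow> heis" where
  "hdil r x = (case x of (x1, x2, x3) \<Rightarrow> (r * x1, r * x2, r^2 * x3))"

definition hnorm :: "heis \<Rightarrow> real" where
  "hnorm x = (case x of (x1, x2, x3) \<Rightarrow> sqrt (x1^2 + x2^2))"

definition vert :: "heis \<Rightarrow> real" where
  "vert x = snd (snd x)"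

definition heis_dist :: "(heis \<Rightarrow> heis \<Rightarrow> real) \<Rightarrow> bool" where
  "heis_dist d \<longleftrightarrow>
     (\<forall>x y. d x y = 0 \<longleftrightarrow> x = y) \<and>
     (\<forall>x y. d x y = d y x) \<and>
     (\<forall>x y z. d x z \<le> d x y + d y z) \<and>
     (\<forall>p x y. d (hmul p x) (hmul p y) = d x y) \<and>
     (\<forall>r x y. r > 0 \<longrightarrow> d (hdil r x) (hdil r y) = r * d x y)"

definition dball :: "(heis \<Rightarrow> heis \<Rightarrow> real) \<Rightarrow> heis \<Rightarrow> real \<Rightarrow> heis set" where
  "dball d x r = {y. d x y < r}"

definition beta_d :: "(heis \<Rightarrow> heis \<Rightarrow> real) \<Rightarrow> ennreal" where
  "beta_d d = (SUP y\<in>{y. d 0 y \<le> 1}. emeasure lborel {\<sigma>::real. (0, 0, \<sigma>) \<in> dball d y 1})"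

definition sph_eps :: "(heis \<Rightarrow> heis \<Rightarrow> real) \<Rightarrow> real \<Rightarrow> heis set \<Rightarrow> ennreal" where
  "sph_eps d eps U = (INF pr \<in> {(p, r). (\<forall>i::nat. 0 < r i \<and> r i \<le> eps) \<and>
                                       U \<subseteq> (\<Union>i. dball d (p i) (r i))}.
        (\<Sum>i. beta_d d * ennreal ((snd pr i)^2)))"

text \<open>Spherical Hausdorff measure: the limit as eps tends to 0 from the right
  (the premeasure is non-increasing in eps, so this is the supremum).\<close>
definition sph2 :: "(heis \<Rightarrow> heis \<Rightarrow> real) \<Rightarrow> heis set \<Rightarrow> ennreal" where
  "sph2 d U = (SUP eps\<in>{0<..}. sph_eps d eps U)"

definition sph2_measure :: "(heis \<Rightarrow> heis \<Rightarrow> real) \<Rightarrow> heis measure" where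
  "sph2_measure d = measure_of UNIV (sets borel) (sph2 d)"

end

(*
  Measured with a homogeneous distance, an increment of the curve over a parameter interval of
  length h has horizontal part o(sqrt h), so at scale sqrt h the curve is the vertical segment of
  signed length (integral of theta).  By homogeneity a ball of radius r meets a vertical line
  through one of its points in a set of measure at most beta r^2.

  Lower bound: where |theta| >= kappa, the part of the curve inside a small ball of radius r has a
  parameter set of diameter O(r^2) (injectivity excludes returns), on which the primitive of theta
  maps it into a vertical section of a ball of radius (1 + kappa) r.  So every efficient cover has
  cost at least about the integral of |theta|.

  Upper bound: the triangle inequality along t -> delta_t x * delta_(1-t) y shows that vertical
  sections of balls are intervals, so suitably translated almost optimal balls cover short arcs
  of the curve at almost the right cost.

  On a compact interval the upper bound is needed only for the whole arc: the measure is additive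
  on Borel sets, and the lower bound for a Borel piece and for its complement forces equality.
*)
theory Submission
  imports Defs
begin

section \<open>Homogeneous distances\<close>

text \<open>Replacing an arc of parameter length h by a vertical segment moves points by at most a
  constant times \<open>sqrt (h * \<omega> h)\<close>. This is negligible only against balls whose
  radius r satisfies r^2 >= const * h, and such a comparison fails where \<theta> is small. Hence a
  parameter \<kappa> > 0 runs through both bounds: the lower bound discards the set where |\<theta>|
  < \<kappa>, whose mass is at most \<open>\<kappa> * (b - a)\<close>; the upper bound covers as if
  the density were |\<theta>| + 2\<kappa>; then \<kappa> tends to 0. The balls of a cover need not
  be centred on the curve. This is why \<beta> is a supremum over all unit balls whose centre has
  distance at most 1 from the origin. Borel sets refer to the Euclidean topology, while
  \<open>heis_dist\<close> is purely metric and algebraic. So the two topologies must be compared in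
  both directions: balls are open, and open sets contain balls around each of their points.
  Cancelling masses needs a finite total, so the identity is proved on compact intervals and passes
  to \<open>I\<close> by continuity from below.\<close>

lemmas heis_ops = hmul_def hinv_def hdil_def hnorm_def vert_def zero_prod_def uminus_prod_def
  split_beta

lemma hmul_assoc: "hmul (hmul x y) z = hmul x (hmul y z)"
  by (simp add: heis_ops algebra_simps)

lemma hmul_0_left [simp]: "hmul 0 x = x"
  and hmul_0_right [simp]: "hmul x 0 = x"
  by (simp_all add: heis_ops)

lemma hmul_hinv_left [simp]: "hmul (hinv x) x = 0"
  and hmul_hinv_right [simp]: "hmul x (hinv x) = 0"
  by (simp_all add: heis_ops)

lemma hmul_hinv_cancel [simp]: "hmul (hinv x) (hmul x y) = y"
  "hmul x (hmul (hinv x) y) = y"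
  by (simp_all add: hmul_assoc[symmetric])

lemma hdil_0 [simp]: "hdil r 0 = 0"
  by (simp add: heis_ops)

lemma hdil_1 [simp]: "hdil 1 x = x"
  by (simp add: heis_ops)

lemma hdil_hdil: "hdil r (hdil s x) = hdil (r * s) x"
  by (simp add: heis_ops power_mult_distrib)

lemma hnorm_nonneg [simp]: "0 \<le> hnorm x"
  by (simp add: heis_ops)

lemma fst_le_hnorm: "\<bar>fst x\<bar> \<le> hnorm x"
  and fst_snd_le_hnorm: "\<bar>fst (snd x)\<bar> \<le> hnorm x"
  by (auto simp: hnorm_def split_beta real_le_rsqrt)

lemma continuous_hmul [continuous_intros]:
  assumes "continuous_on S f" "continuous_on S g"
  shows "continuous_on S (\<lambda>x. hmul (f x) (g x))"
  unfolding hmul_def split_beta by (intro continuous_intros assms)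

lemma continuous_hinv [continuous_intros]:
  "continuous_on S f \<Longrightarrow> continuous_on S (\<lambda>x. hinv (f x))"
  unfolding hinv_def by (intro continuous_intros)

lemma continuous_hdil [continuous_intros]:
  assumes "continuous_on S r" "continuous_on S f"
  shows "continuous_on S (\<lambda>x. hdil (r x) (f x))"
  unfolding hdil_def split_beta by (intro continuous_intros assms)

lemma continuous_hnorm [continuous_intros]:
  "continuous_on S f \<Longrightarrow> continuous_on S (\<lambda>x. hnorm (f x))"
  unfolding hnorm_def split_beta by (intro continuous_intros)

lemma continuous_vert [continuous_intros]:
  "continuous_on S f \<Longrightarrow> continuous_on S (\<lambda>x. vert (f x))"
  unfolding vert_def by (intro continuous_intros)

section \<open>Homogeneous distances as norms on the group\<close>

locale homogeneous_distance =
  fixes d :: "heis \<Rightarrow> heis \<Rightarrow> real"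
  assumes heis_dist: "heis_dist d"
begin

lemma d_eq_0 [simp]: "d x y = 0 \<longleftrightarrow> x = y"
  and d_sym: "d x y = d y x"
  and d_triangle: "d x z \<le> d x y + d y z"
  and d_left: "d (hmul p x) (hmul p y) = d x y"
  and d_hdil: "r > 0 \<Longrightarrow> d (hdil r x) (hdil r y) = r * d x y"
  using heis_dist unfolding heis_dist_def by blast+

lemma d_self [simp]: "d x x = 0"
  by simp

lemma d_nonneg [simp]: "0 \<le> d x y"
  using d_triangle[of x x y] d_sym[of x y] by simp

lemma d_pos: "x \<noteq> y \<Longrightarrow> 0 < d x y"
  using d_nonneg[of x y] d_eq_0[of x y] by linarith

definition N :: "heis \<Rightarrow> real" where "N x = d 0 x"

lemma d_eq_N: "d x y = N (hmul (hinv x) y)"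
  using d_left[of "hinv x" x y] by (simp add: N_def)

lemma N_nonneg [simp]: "0 \<le> N x" by (simp add: N_def)

lemma N_eq_0 [simp]: "N x = 0 \<longleftrightarrow> x = 0" by (auto simp: N_def)

lemma N_hinv [simp]: "N (hinv x) = N x"
  using d_left[of x "hinv x" 0] by (simp add: N_def d_sym)

lemma N_hmul_le: "N (hmul x y) \<le> N x + N y"
  using d_triangle[of 0 "hmul x y" x] d_left[of x 0 y] by (simp add: N_def)

lemma N_hdil: "r > 0 \<Longrightarrow> N (hdil r x) = r * N x"
  using d_hdil[of r 0 x] by (simp add: N_def)

lemma N_diff: "\<bar>N x - N y\<bar> \<le> N (hmul (hinv x) y)"
  using d_triangle[of 0 y x] d_triangle[of 0 x y] d_sym[of x y] unfolding N_def[symmetric] d_eq_N[of x y, symmetric]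
  by linarith

section \<open>Comparison of \<open>N\<close> with coordinates and with the Euclidean
  topology\<close>

lemma N_first_axis: "N (x, 0, 0) = \<bar>x\<bar> * N (1, 0, 0)"
proof -
  have pos: "N (x, 0, 0) = x * N (1, 0, 0)" if "x > 0" for x
    using N_hdil[OF that, of "(1,0,0)"] by (simp add: hdil_def)
  consider "x > 0" | "x = 0" | "x < 0" by linarith
  then show ?thesis
  proof cases
    case 3
    have "N (x, 0, 0) = N (-x, 0, 0)" using N_hinv[of "(x,0,0)"] by (simp add: hinv_def)
    then show ?thesis using pos[of "-x"] 3 by simp
  next
    case 1
    then show ?thesis using pos[OF 1] by simp
  next
    case 2
    then show ?thesis by (simp add: zero_prod_def)
  qed
qed

lemma N_second_axis: "N (0, x, 0) = \<bar>x\<bar> * N (0, 1, 0)"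
proof -
  have pos: "N (0, x, 0) = x * N (0, 1, 0)" if "x > 0" for x
    using N_hdil[OF that, of "(0,1,0)"] by (simp add: hdil_def)
  consider "x > 0" | "x = 0" | "x < 0" by linarith
  then show ?thesis
  proof cases
    case 3
    have "N (0, x, 0) = N (0, -x, 0)" using N_hinv[of "(0,x,0)"] by (simp add: hinv_def)
    then show ?thesis using pos[of "-x"] 3 by simp
  next
    case 1
    then show ?thesis using pos[OF 1] by simp
  next
    case 2
    then show ?thesis by (simp add: zero_prod_def)
  qed
qed

text \<open>Dilations act transitively on the positive half axis and inversion exchanges the two
  halves, so one value determines \<open>N\<close> on the axis. The vertical coordinate has weight 2
  under dilations, hence the square root.\<close>

lemma N_vertical_axis: "N (0, 0, x) = sqrt \<bar>x\<bar> * N (0, 0, 1)"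
proof -
  have pos: "N (0, 0, x) = sqrt x * N (0, 0, 1)" if "x > 0" for x
    using N_hdil[of "sqrt x" "(0,0,1)"] that by (simp add: hdil_def)
  consider "x > 0" | "x = 0" | "x < 0" by linarith
  then show ?thesis
  proof cases
    case 3
    have "N (0, 0, x) = N (0, 0, -x)" using N_hinv[of "(0,0,x)"] by (simp add: hinv_def)
    then show ?thesis using pos[of "-x"] 3 by simp
  next
    case 1
    then show ?thesis using pos[OF 1] by simp
  next
    case 2
    then show ?thesis by (simp add: zero_prod_def)
  qed
qed

text \<open>Every element is a product of three axis elements, and \<open>N\<close> is subadditive.
  The product of the two horizontal factors already has height x1 * x2, so the vertical factor must
  be x3 - x1 * x2; the square root of the extra term is again at most the horizontal norm.\<close>

lemma N_upper:
  obtains C where "C > 0" "\<And>x. N x \<le> C * (hnorm x + sqrt \<bar>vert x\<bar>)"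
proof
  define c1 c2 c3 where "c1 = N (1,0,0)" and "c2 = N (0,1,0)" and "c3 = N (0,0,1)"
  define C where "C = c1 + c2 + 2 * c3 + 1"
  have c: "c1 \<ge> 0" "c2 \<ge> 0" "c3 \<ge> 0" by (simp_all add: c1_def c2_def c3_def)
  then show "C > 0" by (simp add: C_def)
  fix x :: heis
  obtain x1 x2 x3 where x: "x = (x1, x2, x3)" by (cases x)
  define h v where "h = hnorm x" and "v = sqrt \<bar>vert x\<bar>"
  have h0: "h \<ge> 0" "v \<ge> 0" by (simp_all add: h_def v_def)
  have h: "\<bar>x1\<bar> \<le> h" "\<bar>x2\<bar> \<le> h" using fst_le_hnorm[of x] fst_snd_le_hnorm[of x] by (auto simp: h_def x)
  have "sqrt \<bar>x3 - x1 * x2\<bar> \<le> sqrt (\<bar>x3\<bar> + \<bar>x1\<bar> * \<bar>x2\<bar>)"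
    by (simp add: abs_mult[symmetric])
  also have "\<dots> \<le> sqrt (\<bar>x3\<bar> + h * h)"
    using h by (simp add: mult_mono)
  also have "\<dots> \<le> sqrt \<bar>x3\<bar> + sqrt (h * h)" using sqrt_add_le_add_sqrt[of "\<bar>x3\<bar>" "h*h"] by simp
  also have "\<dots> = v + h" using h0 by (simp add: v_def x vert_def)
  finally have 3: "sqrt \<bar>x3 - x1 * x2\<bar> \<le> v + h" .
  have "x = hmul (x1, 0, 0) (hmul (0, x2, 0) (0, 0, x3 - x1 * x2))"
    by (simp add: x hmul_def)
  then have "N x \<le> N (x1, 0, 0) + (N (0, x2, 0) + N (0, 0, x3 - x1 * x2))"
    by (metis N_hmul_le add_left_mono order_trans)
  also have "\<dots> = \<bar>x1\<bar> * c1 + (\<bar>x2\<bar> * c2 + sqrt \<bar>x3 - x1 * x2\<bar> * c3)"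
    by (simp add: N_first_axis[of x1] N_second_axis[of x2] N_vertical_axis[of "x3 - x1 * x2"] c1_def c2_def c3_def)
  also have "\<dots> \<le> h * c1 + (h * c2 + (v + h) * c3)"
    using h 3 c by (intro add_mono mult_right_mono) auto
  also have "\<dots> \<le> C * (h + v)"
    using c h0 by (simp add: C_def algebra_simps)
  finally show "N x \<le> C * (hnorm x + sqrt \<bar>vert x\<bar>)" by (simp add: h_def v_def)
qed

text \<open>The variation of \<open>N\<close> between x and y is at most \<open>N\<close> of the
  increment, and \<open>N_upper\<close> bounds this by a continuous function of y that vanishes at y
  = x.\<close>

lemma continuous_N: "continuous_on UNIV N"
proof -
  obtain C where C: "C > 0" "\<And>x. N x \<le> C * (hnorm x + sqrt \<bar>vert x\<bar>)" by (rule N_upper) blast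
  have "isCont N x" for x
  proof -
    let ?g = "\<lambda>y. C * (hnorm (hmul (hinv x) y) + sqrt \<bar>vert (hmul (hinv x) y)\<bar>)"
    have "continuous_on UNIV ?g" by (intro continuous_intros)
    then have "(?g \<longlongrightarrow> ?g x) (at x)"
      by (meson UNIV_I continuous_on_eq_continuous_at isCont_def open_UNIV)
    then have g: "(?g \<longlongrightarrow> 0) (at x)" by (simp add: hnorm_def vert_def zero_prod_def)
    have "\<bar>N y - N x\<bar> \<le> ?g y" for y
      using N_diff[of x y] C(2)[of "hmul (hinv x) y"] by linarith
    then have "((\<lambda>y. N y - N x) \<longlongrightarrow> 0) (at x)"
      by (intro Lim_null_comparison[OF _ g]) auto
    then show ?thesis unfolding isCont_def by (simp add: LIM_zero_iff)
  qed
  then show ?thesis by (simp add: continuous_on_eq_continuous_at)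
qed

lemma continuous_d [continuous_intros]:
  assumes "continuous_on S f" "continuous_on S g"
  shows "continuous_on S (\<lambda>x. d (f x) (g x))"
proof -
  have *: "(\<lambda>x. N (hmul (hinv (f x)) (g x))) = (\<lambda>x. d (f x) (g x))"
    by (intro ext d_eq_N[symmetric])
  have "continuous_on S (\<lambda>x. N (hmul (hinv (f x)) (g x)))"
    by (rule continuous_on_compose2[OF continuous_N]) (auto intro!: continuous_intros assms)
  then show ?thesis by (subst (asm) *)
qed

lemma open_dball: "open (dball d p r)"
  unfolding dball_def by (intro open_Collect_less continuous_intros)

text \<open>\<open>N\<close> has a positive minimum c on the Euclidean unit sphere. A point outside
  the unit ball is brought onto the sphere by a dilation with factor at most 1, which can only
  decrease \<open>N\<close>.\<close>

lemma N_lower: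
  obtains c where "0 < c" "\<And>x. N x < c \<Longrightarrow> norm x < 1"
proof -
  let ?S = "sphere 0 1 :: heis set"
  have "?S \<noteq> {}" by simp
  then obtain z where z: "z \<in> ?S" "\<And>y. y \<in> ?S \<Longrightarrow> N z \<le> N y"
    using continuous_attains_inf[of ?S N] continuous_on_subset[OF continuous_N] compact_sphere
    by (metis subset_UNIV)
  have "z \<noteq> 0" using z(1) by auto
  then have c: "0 < N z" using N_nonneg[of z] by (simp add: order_less_le)
  have "N z \<le> N x" if x: "norm x \<ge> 1" for x
  proof -
    have "continuous_on {0..1} (\<lambda>r. norm (hdil r x))" by (intro continuous_intros)
    moreover have "norm (hdil 0 x) = 0" by (simp add: hdil_def split_beta norm_prod_def)
    moreover have "norm (hdil 1 x) \<ge> 1" using x by simp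
    ultimately obtain r where r: "0 \<le> r" "r \<le> 1" "norm (hdil r x) = 1"
      using IVT'[of "\<lambda>r. norm (hdil r x)" 0 1 1] by auto
    have r0: "r > 0" using r \<open>norm (hdil 0 x) = 0\<close> by (cases "r = 0") auto
    have "N z \<le> N (hdil r x)" using r by (intro z) simp
    also have "\<dots> = r * N x" using r0 by (rule N_hdil)
    also have "\<dots> \<le> N x" using r by (simp add: mult_left_le_one_le)
    finally show ?thesis .
  qed
  then show ?thesis using c that[of "N z"] by (meson not_less)
qed

lemma vert_upper:
  obtains K where "K > 0" "\<And>x. \<bar>vert x\<bar> \<le> K * (N x)\<^sup>2"
proof -
  obtain c where c: "0 < c" "\<And>x. N x < c \<Longrightarrow> norm x < 1" by (rule N_lower) blast
  have "\<bar>vert x\<bar> \<le> (4 / c\<^sup>2) * (N x)\<^sup>2" for x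
  proof (cases "x = 0")
    case True
    then show ?thesis by (simp add: vert_def)
  next
    case False
    \<comment> \<open>This dilation normalises x to \<open>N\<close> = c/2, inside the region
      controlled by \<open>N_lower\<close>; undoing it divides the height bound 1 by r^2, which is
      where 4 / c^2 comes from.\<close>
    define r where "r = c / (2 * N x)"
    have Nx: "N x > 0" using False N_nonneg[of x] by (simp add: order_less_le)
    have r: "r > 0" using c Nx by (simp add: r_def)
    have "N (hdil r x) < c" using N_hdil[OF r, of x] c Nx by (simp add: r_def)
    then have "norm (hdil r x) < 1" by (rule c)
    moreover have "\<bar>vert w\<bar> \<le> norm w" for w
      using norm_snd_le[of "snd (snd w)" "fst (snd w)"] norm_snd_le[of "snd w" "fst w"]
      by (simp add: vert_def)
    ultimately have "\<bar>vert (hdil r x)\<bar> < 1" by (rule le_less_trans[rotated])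
    then have "\<bar>r\<^sup>2 * vert x\<bar> < 1" by (simp add: vert_def hdil_def split_beta)
    then have "\<bar>vert x\<bar> * r\<^sup>2 < 1" by (simp add: abs_mult mult.commute)
    then have "\<bar>vert x\<bar> < 1 / r\<^sup>2" using r by (simp add: pos_less_divide_eq)
    then show ?thesis using c Nx by (simp add: r_def power_divide power_mult_distrib field_simps)
  qed
  moreover have "4 / c\<^sup>2 > 0" using c by simp
  ultimately show ?thesis using that by blast
qed

text \<open>The sets x * \<delta>_e(K), with K the closed Euclidean unit ball, collapse to x as e
  tends to 0. The tube lemma on the compact K yields a single e > 0 for which the whole set lies in
  G, and by \<open>N_lower\<close> this set contains the ball of radius c * e.\<close>

lemma open_contains_dball:
  assumes "open G" "x \<in> G"
  obtains r where "r > 0" "dball d x r \<subseteq> G"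
proof -
  obtain c where c: "0 < c" "\<And>x. N x < c \<Longrightarrow> norm x < 1" by (rule N_lower) blast
  have cont: "continuous_on UNIV (\<lambda>p. hmul x (hdil (fst p) (snd p)))" by (intro continuous_intros)
  let ?H = "(\<lambda>p. hmul x (hdil (fst p) (snd p))) -` G :: (real \<times> heis) set"
  have opH: "open ?H" using open_vimage[OF assms(1) cont] .
  have "{0} \<times> cball 0 1 \<subseteq> ?H"
    using assms(2) by (auto simp: heis_ops)
  from Elementary_Topology.tube_lemma[OF compact_cball opH this]
  obtain A where A: "open A" "0 \<in> A" "A \<times> cball 0 1 \<subseteq> ?H" by blast
  then obtain e where e: "e > 0" "cball 0 e \<subseteq> A" by (meson open_contains_cball)
  have "dball d x (c * e) \<subseteq> G"
  proof
    fix y assume "y \<in> dball d x (c * e)"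
    then have "N (hmul (hinv x) y) < c * e" by (simp add: dball_def d_eq_N)
    then have "N (hdil (1/e) (hmul (hinv x) y)) < c" using e c
      by (simp add: N_hdil field_simps)
    then have "norm (hdil (1/e) (hmul (hinv x) y)) < 1" by (rule c)
    then have "(e, hdil (1/e) (hmul (hinv x) y)) \<in> A \<times> cball 0 1"
      using e subsetD[OF e(2), of e] by simp
    then have "(e, hdil (1/e) (hmul (hinv x) y)) \<in> ?H" using A(3) by (rule subsetD[rotated])
    then show "y \<in> G" using e by (simp add: hdil_hdil)
  qed
  then show ?thesis using that[of "c*e"] c e by simp
qed

section \<open>Vertical sections of balls and the constant \<beta>\<close>

definition vsec :: "heis \<Rightarrow> real \<Rightarrow> real set" where
  "vsec y r = {\<sigma>. (0, 0, \<sigma>) \<in> dball d y r}"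

lemma beta_d_eq: "beta_d d = (SUP y\<in>{y. d 0 y \<le> 1}. emeasure lborel (vsec y 1))"
  by (simp add: beta_d_def vsec_def)

lemma open_vsec: "open (vsec y r)"
  unfolding vsec_def dball_def mem_Collect_eq by (intro open_Collect_less continuous_intros)

lemma vsec_borel [measurable]: "vsec y r \<in> sets borel"
  using open_vsec by auto

text \<open>Points \<open>x\<close>, \<open>x'\<close> on one vertical line have parallel horizontal parts, so
  \<open>\<delta>\<^sub>t x' \<sqdot> \<delta>\<^sub>1\<^sub>-\<^sub>t x\<close> stays on that line; its height runs continuously from
  that of \<open>x\<close> to that of \<open>x'\<close>, while its distance to the origin stays below 1.\<close>

lemma is_interval_vsec: "is_interval (vsec y 1)"
  unfolding is_interval_1
proof (intro ballI allI impI, elim conjE)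
  fix s s' v assume s: "s \<in> vsec y 1" and s': "s' \<in> vsec y 1" and v: "s \<le> v" "v \<le> s'"
  define z :: heis where "z = hinv y"
  obtain z1 z2 z3 where z: "z = (z1, z2, z3)" by (cases z)
  have mem: "\<sigma> \<in> vsec y 1 \<longleftrightarrow> N (z1, z2, z3 + \<sigma>) < 1" for \<sigma>
    by (simp add: vsec_def dball_def d_eq_N z_def[symmetric] z hmul_def)
  let ?g = "\<lambda>t. t\<^sup>2 * (z3 + s') + (1 - t)\<^sup>2 * (z3 + s) - z3"
  have "continuous_on {0..1} ?g" by (intro continuous_intros)
  then obtain t where t: "0 \<le> t" "t \<le> 1" "?g t = v"
    using IVT'[of ?g 0 v 1] v by auto
  show "v \<in> vsec y 1"
  proof (cases "t = 0 \<or> t = 1")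
    case True
    then show ?thesis using t s s' by auto
  next
    case False
    then have t': "0 < t" "t < 1" using t by auto
    have "hmul (hdil t (z1, z2, z3 + s')) (hdil (1 - t) (z1, z2, z3 + s)) = (z1, z2, z3 + v)"
      using t(3) by (simp add: hmul_def hdil_def algebra_simps)
    then have "N (z1, z2, z3 + v) \<le> t * N (z1, z2, z3 + s') + (1 - t) * N (z1, z2, z3 + s)"
      by (metis N_hmul_le N_hdil t' diff_gt_0_iff_gt)
    also have "\<dots> < t * 1 + (1 - t) * 1"
      using s s' t' mem by (intro add_strict_mono mult_strict_left_mono) auto
    finally show ?thesis by (simp add: mem)
  qed
qed

lemma d_vertical_scale:
  assumes "r > 0"
  shows "d (hdil r y) (0, 0, \<sigma>) = r * d y (0, 0, \<sigma> / r\<^sup>2)"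
  using d_hdil[OF assms, of y "(0,0,\<sigma> / r\<^sup>2)"] assms by (simp add: hdil_def)

text \<open>Dilation by 1/r brings the ball to radius 1 and its centre into the range of the
  supremum defining \<beta>; on the vertical axis it scales Lebesgue measure by r^{-2}.\<close>

lemma emeasure_vsec_le:
  assumes r: "r > 0" and y: "d 0 y \<le> r"
  shows "emeasure lborel (vsec y r) \<le> ennreal (r\<^sup>2) * beta_d d"
proof -
  define y' where "y' = hdil (1 / r) y"
  have y'y: "y = hdil r y'" using r by (simp add: y'_def hdil_hdil)
  have "d 0 y' \<le> 1" using y r N_hdil[of "1/r" y] by (simp add: N_def[symmetric] y'_def)
  then have le: "emeasure lborel (vsec y' 1) \<le> beta_d d"
    unfolding beta_d_eq by (intro SUP_upper) simp
  have eq: "vsec y' 1 = (\<lambda>\<sigma>. 0 + r\<^sup>2 * \<sigma>) -` vsec y r"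
    using r d_vertical_scale[OF r, of y'] by (auto simp: vsec_def dball_def y'y)
  have "emeasure lborel (vsec y r) = ennreal \<bar>r\<^sup>2\<bar> * emeasure lborel (vsec y' 1)"
    using r by (subst lborel_real_affine[of "r\<^sup>2" 0])
      (simp_all add: emeasure_density nn_integral_cmult emeasure_distr eq)
  then show ?thesis using le by (simp add: mult_left_mono)
qed

text \<open>A point of the section has \<open>N\<close> at most 2 by the triangle inequality, so its
  height is at most 4K in absolute value.\<close>

lemma beta_finite: "beta_d d < \<infinity>"
proof -
  obtain K where K: "K > 0" "\<And>x. \<bar>vert x\<bar> \<le> K * (N x)\<^sup>2" by (rule vert_upper) blast
  have "emeasure lborel (vsec y 1) \<le> ennreal (8 * K)" if y: "d 0 y \<le> 1" for y
  proof -
    have "\<bar>\<sigma>\<bar> \<le> 4 * K" if "\<sigma> \<in> vsec y 1" for \<sigma>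
    proof -
      have "N (0, 0, \<sigma>) \<le> 2" using that y d_triangle[of 0 "(0,0,\<sigma>)" y]
        by (auto simp: vsec_def dball_def N_def)
      then have "(N (0, 0, \<sigma>))\<^sup>2 \<le> 2\<^sup>2" by (intro power_mono) auto
      then have "K * (N (0, 0, \<sigma>))\<^sup>2 \<le> K * 4" using K by simp
      then show ?thesis using K(2)[of "(0,0,\<sigma>)"] by (simp add: vert_def)
    qed
    then have "vsec y 1 \<subseteq> {- (4 * K) .. 4 * K}" by (force simp: abs_le_iff)
    then have "emeasure lborel (vsec y 1) \<le> emeasure lborel {- (4 * K) .. 4 * K}"
      by (intro emeasure_mono) auto
    then show ?thesis using K by simp
  qed
  then have "beta_d d \<le> ennreal (8 * K)" unfolding beta_d_eq by (intro SUP_least) simp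
  then show ?thesis by (simp add: order_le_less_trans)
qed

definition \<beta> :: real where "\<beta> = enn2real (beta_d d)"

lemma beta_d_\<beta>: "beta_d d = ennreal \<beta>"
  using beta_finite by (simp add: \<beta>_def)

lemma \<beta>_pos: "\<beta> > 0"
proof -
  have "0 \<in> vsec 0 1" by (simp add: vsec_def dball_def zero_prod_def)
  then obtain e where e: "e > 0" "cball 0 e \<subseteq> vsec 0 1"
    using open_vsec[of 0 1] by (meson open_contains_cball)
  then have "{0..e} \<subseteq> vsec 0 1" by (auto simp: subset_iff)
  then have "emeasure lborel {0..e} \<le> emeasure lborel (vsec 0 1)"
    by (intro emeasure_mono) auto
  then have "emeasure lborel (vsec 0 1) \<noteq> 0" using e by auto
  moreover have "emeasure lborel (vsec 0 1) \<le> beta_d d"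
    unfolding beta_d_eq by (intro SUP_upper) (simp add: d_eq_0)
  ultimately have "beta_d d \<noteq> 0" by auto
  then show ?thesis using beta_d_\<beta> by (metis ennreal_neg not_less)
qed

text \<open>The supremum defining \<beta> need not be attained, hence l < \<beta>. A section of
  measure above l contains two points at distance at least l, since otherwise it would fit into an
  interval of length l; being an interval, it contains the segment between them.\<close>

lemma long_section:
  assumes "l < \<beta>" "0 < l"
  obtains y \<alpha> where "\<And>\<sigma>. \<alpha> \<le> \<sigma> \<Longrightarrow> \<sigma> \<le> \<alpha> + l \<Longrightarrow> d y (0, 0, \<sigma>) < 1"
proof -
  have "ennreal l < beta_d d" using assms by (simp add: beta_d_\<beta> ennreal_less_iff)
  then obtain y where y: "ennreal l < emeasure lborel (vsec y 1)"
    unfolding beta_d_eq less_SUP_iff by blast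
  have "\<exists>s1\<in>vsec y 1. \<exists>s2\<in>vsec y 1. l \<le> s2 - s1"
  proof (rule ccontr)
    assume "\<not> ?thesis"
    then have short: "s2 - s1 < l" if "s1 \<in> vsec y 1" "s2 \<in> vsec y 1" for s1 s2
      using that by (meson not_le)
    obtain s0 where s0: "s0 \<in> vsec y 1" using y by fastforce
    have bdd: "bdd_below (vsec y 1)" using short[OF _ s0] by (intro bdd_belowI[of _ "s0 - l"]) (smt (verit))
    have "vsec y 1 \<subseteq> {Inf (vsec y 1) .. Inf (vsec y 1) + l}"
    proof
      fix s assume s: "s \<in> vsec y 1"
      have "s - l \<le> Inf (vsec y 1)" using s0 short[OF _ s] by (intro cInf_greatest) (auto, smt (verit))
      then show "s \<in> {Inf (vsec y 1) .. Inf (vsec y 1) + l}"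
        using cInf_lower[OF s bdd] by auto
    qed
    then have "emeasure lborel (vsec y 1) \<le> emeasure lborel {Inf (vsec y 1) .. Inf (vsec y 1) + l}"
      by (intro emeasure_mono) auto
    then show False using y assms by simp
  qed
  then obtain s1 s2 where s: "s1 \<in> vsec y 1" "s2 \<in> vsec y 1" "l \<le> s2 - s1" by blast
  have "d y (0, 0, \<sigma>) < 1" if "s1 \<le> \<sigma>" "\<sigma> \<le> s1 + l" for \<sigma>
  proof -
    have "\<sigma> \<in> vsec y 1" using is_interval_vsec[of y] s that unfolding is_interval_1
      by (metis add.commute le_diff_eq order_trans)
    then show ?thesis by (simp add: vsec_def dball_def)
  qed
  then show ?thesis using that by blast
qed

end

section \<open>The spherical measure as a Borel measure\<close>

lemma suminf_half_powers: "e \<ge> 0 \<Longrightarrow> (\<Sum>i. ennreal (e * (1/2) ^ Suc i)) = ennreal e"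
  using sums_mult[OF power_half_series, of e]
  by (subst suminf_ennreal2) (auto simp: sums_iff)

lemma suminf_subadditive_Un:
  fixes \<mu> :: "'a set \<Rightarrow> ennreal"
  assumes "\<mu> {} = 0" and "\<And>A :: nat \<Rightarrow> 'a set. \<mu> (\<Union>i. A i) \<le> (\<Sum>i. \<mu> (A i))"
  shows "\<mu> (P \<union> Q) \<le> \<mu> P + \<mu> Q"
  using assms(2)[of "binaryset P Q"] suminf_binaryset_eq[of \<mu> P Q] assms(1)
  by (simp add: UN_binaryset_eq o_def)

text \<open>Superadditivity is accumulated one set at a time. The step is asked for only when n > 0:
  the union over k < 0 is empty, and the application uses an index 2n + p - 1 that would otherwise
  be truncated.\<close>

lemma separated_sum_le:
  fixes \<mu> :: "'a set \<Rightarrow> ennreal" and R :: "nat \<Rightarrow> 'a set"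
  assumes zero: "\<mu> {} = 0"
    and step: "\<And>n. n > 0 \<Longrightarrow> \<mu> (\<Union>k<n. R k) + \<mu> (R n) \<le> \<mu> ((\<Union>k<n. R k) \<union> R n)"
  shows "(\<Sum>k<n. \<mu> (R k)) \<le> \<mu> (\<Union>k<n. R k)"
proof (induction n)
  case (Suc n)
  have "(\<Sum>k<Suc n. \<mu> (R k)) \<le> \<mu> (\<Union>k<n. R k) + \<mu> (R n)"
    using Suc by (simp add: add_right_mono add.commute)
  also have "\<dots> \<le> \<mu> (\<Union>k<Suc n. R k)"
    using step[of n] zero by (cases "n = 0") (auto simp: lessThan_Suc Un_commute)
  finally show ?case .
qed (simp add: zero)

text \<open>\<open>A - F\<close> is exhausted by the sets \<open>A \<inter> D n\<close>, each at
  positive distance from \<open>F\<close>. What remains is a union of rings \<open>R\<close>;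
  alternate rings are separated, so the measures of all rings sum to at most 2 \<mu>(A), and the
  tail of this convergent series is negligible.\<close>

lemma metric_outer_measure_closed:
  fixes m :: "'a \<Rightarrow> 'a \<Rightarrow> real" and \<mu> :: "'a set \<Rightarrow> ennreal"
  assumes tri: "\<And>x y z. m x z \<le> m x y + m y z"
    and zero: "\<mu> {} = 0" and mono: "\<And>A B. A \<subseteq> B \<Longrightarrow> \<mu> A \<le> \<mu> B"
    and csub: "\<And>A :: nat \<Rightarrow> 'a set. \<mu> (\<Union>i. A i) \<le> (\<Sum>i. \<mu> (A i))"
    and sep: "\<And>A B e. e > 0 \<Longrightarrow> (\<And>x y. x \<in> A \<Longrightarrow> y \<in> B \<Longrightarrow> e \<le> m x y) \<Longrightarrow> \<mu> A + \<mu> B \<le> \<mu> (A \<union> B)"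
    and closed: "\<And>x. x \<notin> F \<Longrightarrow> \<exists>e>0. \<forall>y\<in>F. e \<le> m x y"
  shows "\<mu> (A \<inter> F) + \<mu> (A - F) \<le> \<mu> A"
proof (cases "\<mu> A = \<infinity>")
  case fin: False
  define D where "D n = {x. \<forall>y\<in>F. 1 / real (Suc n) \<le> m x y}" for n
  define R where "R n = A \<inter> (D (Suc n) - D n)" for n
  have Dmono: "D i \<subseteq> D j" if "i \<le> j" for i j
  proof
    fix x assume x: "x \<in> D i"
    have "1 / real (Suc j) \<le> 1 / real (Suc i)" using that by (intro divide_left_mono) auto
    then show "x \<in> D j" using x unfolding D_def by fastforce
  qed
  have DUn: "\<exists>n. x \<in> D n" if "x \<notin> F" for x
  proof -
    obtain e where e: "e > 0" "\<And>y. y \<in> F \<Longrightarrow> e \<le> m x y" using closed[OF \<open>x \<notin> F\<close>] by blast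
    obtain n where "1 / real (Suc n) < e" using nat_approx_posE[OF e(1)] by blast
    then have "x \<in> D n" unfolding D_def using e(2) by force
    then show ?thesis ..
  qed
  have two: "\<mu> (P \<union> Q) \<le> \<mu> P + \<mu> Q" for P Q
    by (rule suminf_subadditive_Un[where \<mu> = \<mu>, OF zero csub])
  \<comment> \<open>A point outside \<open>D (Suc j)\<close> lies within 1/(j+2) of some z in
    \<open>F\<close>, while points of \<open>D j\<close> are at least 1/(j+1) away from z; the
    difference of these radii separates the two sets.\<close>
  have DD: "\<mu> P + \<mu> Q \<le> \<mu> (P \<union> Q)" if PQ: "P \<subseteq> D j" "Q \<inter> D (Suc j) = {}" for P Q j
  proof (rule sep)
    show "0 < 1 / real (Suc j) - 1 / real (Suc (Suc j))" by (simp add: divide_strict_left_mono)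
    fix x y assume x: "x \<in> P" and y: "y \<in> Q"
    then obtain z where z: "z \<in> F" "m y z < 1 / real (Suc (Suc j))"
      using PQ by (force simp: D_def)
    have "1 / real (Suc j) \<le> m x z" using x PQ z by (auto simp: D_def)
    also have "\<dots> \<le> m x y + m y z" by (rule tri)
    finally show "1 / real (Suc j) - 1 / real (Suc (Suc j)) \<le> m x y" using z by linarith
  qed
  \<comment> \<open>Rings whose indices have the same parity are separated from each other.\<close>
  have half: "(\<Sum>k<n. \<mu> (R (2 * k + p))) \<le> \<mu> A" for n p
  proof -
    have "(\<Sum>k<n. \<mu> (R (2 * k + p))) \<le> \<mu> (\<Union>k<n. R (2 * k + p))"
    proof (rule separated_sum_le[where \<mu> = \<mu>, OF zero])
      fix n :: nat assume n: "n > 0"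
      \<comment> \<open>The last ring before \<open>R (2 * n + p)\<close> has index 2n + p - 2 and
        so lies in \<open>D j\<close>; the ring \<open>R (2 * n + p)\<close> itself avoids
        \<open>D (2 * n + p)\<close>, which is \<open>D (Suc j)\<close>.\<close>
      define j where "j = 2 * n + p - 1"
      have "(\<Union>k<n. R (2 * k + p)) \<subseteq> D j"
      proof (rule UN_least)
        fix k assume "k \<in> {..<n}"
        then have "D (Suc (2 * k + p)) \<subseteq> D j" using n by (intro Dmono) (auto simp: j_def)
        then show "R (2 * k + p) \<subseteq> D j" by (auto simp: R_def)
      qed
      moreover have "R (2 * n + p) \<inter> D (Suc j) = {}" using n by (auto simp: R_def j_def)
      ultimately show "\<mu> (\<Union>k<n. R (2 * k + p)) + \<mu> (R (2 * n + p))
          \<le> \<mu> ((\<Union>k<n. R (2 * k + p)) \<union> R (2 * n + p))" by (rule DD)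
    qed
    also have "\<dots> \<le> \<mu> A" by (rule mono) (auto simp: R_def)
    finally show ?thesis .
  qed
  have "(\<Sum>j<2 * n. \<mu> (R j)) = (\<Sum>k<n. \<mu> (R (2 * k + 0))) + (\<Sum>k<n. \<mu> (R (2 * k + 1)))" for n
    by (induction n) (simp_all add: algebra_simps)
  then have "(\<Sum>j<2 * n. \<mu> (R j)) \<le> \<mu> A + \<mu> A" for n
    using add_mono[OF half half] by metis
  moreover have "(\<Sum>j<n. \<mu> (R j)) \<le> (\<Sum>j<2 * n. \<mu> (R j))" for n
    by (intro sum_mono2) auto
  ultimately have "(\<Sum>j<n. \<mu> (R j)) \<le> \<mu> A + \<mu> A" for n using order_trans by blast
  then have "(\<Sum>j. \<mu> (R j)) \<le> \<mu> A + \<mu> A" unfolding suminf_eq_SUP by (intro SUP_least)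
  also have "\<dots> < \<infinity>" using fin by (simp add: less_top)
  finally have sfin: "(\<Sum>j. \<mu> (R j)) < \<infinity>" .
  define r where "r j = enn2real (\<mu> (R j))" for j
  have "\<mu> (R j) \<le> \<mu> A" for j by (rule mono) (auto simp: R_def)
  then have r: "\<mu> (R j) = ennreal (r j)" "r j \<ge> 0" for j
    using fin unfolding r_def by (metis ennreal_enn2real infinity_ennreal_def le_less_trans less_top, simp)
  have summ: "summable r" using sfin r by (intro summable_suminf_not_top) auto
  show ?thesis
  proof (rule ennreal_le_epsilon)
    fix e :: real assume e: "e > 0"
    obtain n where n: "norm (\<Sum>i. r (i + n)) < e" using suminf_exist_split[OF e summ] by blast
    have "A - F \<subseteq> (A \<inter> D n) \<union> (\<Union>i. R (i + n))"
    proof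
      fix x assume x: "x \<in> A - F"
      show "x \<in> (A \<inter> D n) \<union> (\<Union>i. R (i + n))"
      proof (cases "x \<in> D n")
        case False
        define k where "k = (LEAST k. x \<in> D k)"
        have k: "x \<in> D k" unfolding k_def using DUn[of x] x by (auto intro: LeastI_ex)
        then have "n < k" using False Dmono[of k n] by (meson not_le subsetD)
        moreover have "x \<notin> D (k - 1)" using not_less_Least[of "k - 1" "\<lambda>k. x \<in> D k"] \<open>n < k\<close>
          by (simp add: k_def)
        ultimately have "x \<in> R ((k - 1 - n) + n)" using x k by (simp add: R_def)
        then show ?thesis by blast
      qed (use x in auto)
    qed
    then have "\<mu> (A - F) \<le> \<mu> (A \<inter> D n) + \<mu> (\<Union>i. R (i + n))" by (rule order_trans[OF mono two])
    also have "\<mu> (\<Union>i. R (i + n)) \<le> (\<Sum>i. \<mu> (R (i + n)))" by (rule csub)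
    also have "\<dots> = ennreal (\<Sum>i. r (i + n))"
      using summ by (simp add: r suminf_ennreal2 summable_ignore_initial_segment)
    also have "\<dots> \<le> ennreal e" using n by (intro ennreal_leI) simp
    finally have 1: "\<mu> (A - F) \<le> \<mu> (A \<inter> D n) + ennreal e" by (simp add: add_left_mono)
    have "\<mu> (A \<inter> D n) + \<mu> (A \<inter> F) \<le> \<mu> ((A \<inter> D n) \<union> (A \<inter> F))"
      by (rule sep[of "1 / real (Suc n)"]) (auto simp: D_def)
    also have "\<dots> \<le> \<mu> A" by (rule mono) auto
    finally have 2: "\<mu> (A \<inter> D n) + \<mu> (A \<inter> F) \<le> \<mu> A" .
    have "\<mu> (A \<inter> F) + \<mu> (A - F) \<le> \<mu> (A \<inter> F) + (\<mu> (A \<inter> D n) + ennreal e)"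
      using 1 by (rule add_left_mono)
    also have "\<dots> \<le> \<mu> A + ennreal e" using 2 by (metis add.assoc add.commute add_right_mono)
    finally show "\<mu> (A \<inter> F) + \<mu> (A - F) \<le> \<mu> A + ennreal e" .
  qed
qed simp

text \<open>Closed sets are Caratheodory measurable and generate the Borel sets. Here closed refers
  to the topology of the type; \<open>fine\<close> is what places each point outside a closed set at
  positive \<open>m\<close>-distance from it.\<close>

lemma metric_outer_measure_space_borel:
  fixes m :: "'a::topological_space \<Rightarrow> 'a \<Rightarrow> real" and \<mu> :: "'a set \<Rightarrow> ennreal"
  assumes tri: "\<And>x y z. m x z \<le> m x y + m y z"
    and zero: "\<mu> {} = 0" and mono: "\<And>A B. A \<subseteq> B \<Longrightarrow> \<mu> A \<le> \<mu> B"
    and csub: "\<And>A :: nat \<Rightarrow> 'a set. \<mu> (\<Union>i. A i) \<le> (\<Sum>i. \<mu> (A i))"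
    and sep: "\<And>A B e. e > 0 \<Longrightarrow> (\<And>x y. x \<in> A \<Longrightarrow> y \<in> B \<Longrightarrow> e \<le> m x y) \<Longrightarrow> \<mu> A + \<mu> B \<le> \<mu> (A \<union> B)"
    and fine: "\<And>G x. open G \<Longrightarrow> x \<in> G \<Longrightarrow> \<exists>e>0. {y. m x y < e} \<subseteq> G"
  shows "measure_space UNIV (sets borel) \<mu>"
proof -
  let ?L = "lambda_system UNIV (Pow UNIV) \<mu>"
  have oms: "outer_measure_space (Pow UNIV) \<mu>"
    using zero mono csub
    by (auto simp: outer_measure_space_def positive_def increasing_def countably_subadditive_def)
  have L: "measure_space UNIV ?L \<mu>"
    by (rule sigma_algebra.caratheodory_lemma[OF sigma_algebra_Pow oms])
  then interpret L: sigma_algebra UNIV ?L by (simp add: measure_space_def)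
  have two: "\<mu> (P \<union> Q) \<le> \<mu> P + \<mu> Q" for P Q
    by (rule suminf_subadditive_Un[where \<mu> = \<mu>, OF zero csub])
  have "F \<in> ?L" if F: "closed F" for F
  proof -
    have cl: "\<exists>e>0. \<forall>y\<in>F. e \<le> m x y" if "x \<notin> F" for x
      using fine[of "- F" x] F that by (auto simp: subset_iff not_less[symmetric])
    have "\<mu> (F \<inter> A) + \<mu> ((UNIV - F) \<inter> A) = \<mu> A" for A
    proof (rule antisym)
      have "\<mu> (A \<inter> F) + \<mu> (A - F) \<le> \<mu> A"
        by (rule metric_outer_measure_closed[where m = m]) (fact tri zero mono csub sep cl)+
      then show "\<mu> (F \<inter> A) + \<mu> ((UNIV - F) \<inter> A) \<le> \<mu> A"
        by (simp add: Int_commute Diff_eq)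
      have "\<mu> A \<le> \<mu> ((F \<inter> A) \<union> ((UNIV - F) \<inter> A))" by (rule mono) auto
      then show "\<mu> A \<le> \<mu> (F \<inter> A) + \<mu> ((UNIV - F) \<inter> A)" using two order_trans by blast
    qed
    then show ?thesis by (simp add: lambda_system_def)
  qed
  then have "sigma_sets UNIV (Collect closed) \<subseteq> ?L"
    by (intro L.sigma_sets_subset) auto
  then have sub: "sets borel \<subseteq> ?L" by (simp add: borel_eq_closed)
  show ?thesis
    unfolding measure_space_def
  proof (intro conjI)
    show "sigma_algebra UNIV (sets (borel :: 'a measure))"
      using sets.sigma_algebra_axioms[of "borel :: 'a measure"] by simp
    show "positive (sets borel) \<mu>" by (simp add: positive_def zero)
    have "countably_additive ?L \<mu>" using L by (simp add: measure_space_def)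
    then show "countably_additive (sets borel) \<mu>"
      using sub by (meson countably_additive_def order_trans subsetD)
  qed
qed

context homogeneous_distance
begin

section \<open>Covers by balls and the spherical premeasure\<close>

lemma sph_cost: "beta_d d * ennreal (r\<^sup>2) = ennreal (\<beta> * r\<^sup>2)"
  using \<beta>_pos by (simp add: beta_d_\<beta> ennreal_mult)

lemma sph_eps_le:
  assumes "\<And>i::nat. 0 < r i \<and> r i \<le> e" "A \<subseteq> (\<Union>i. dball d (p i) (r i))"
  shows "sph_eps d e A \<le> (\<Sum>i. ennreal (\<beta> * (r i)\<^sup>2))"
  unfolding sph_eps_def sph_cost by (rule INF_lower2[of "(p, r)"]) (use assms in auto)

lemma sph_eps_lessE:
  assumes "sph_eps d e A < x"
  obtains p r where "\<And>i::nat. 0 < r i \<and> r i \<le> e" "A \<subseteq> (\<Union>i. dball d (p i) (r i))"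
    "(\<Sum>i. ennreal (\<beta> * (r i)\<^sup>2)) < x"
  using assms unfolding sph_eps_def sph_cost INF_less_iff by auto

lemma sph_eps_le_family:
  fixes K :: "nat set"
  assumes e: "0 < e" and r: "\<And>i. i \<in> K \<Longrightarrow> 0 < r i \<and> r i \<le> e"
    and cover: "A \<subseteq> (\<Union>i\<in>K. dball d (p i) (r i))"
  shows "sph_eps d e A \<le> (\<Sum>i. if i \<in> K then ennreal (\<beta> * (r i)\<^sup>2) else 0)"
proof (rule ennreal_le_epsilon)
  fix \<delta> :: real assume \<delta>: "\<delta> > 0"
  define s where "s i = (if i \<in> K then r i else min e (sqrt (\<delta> * (1/2) ^ Suc i / \<beta>)))" for i
  have "sph_eps d e A \<le> (\<Sum>i. ennreal (\<beta> * (s i)\<^sup>2))"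
  proof (rule sph_eps_le)
    show "0 < s i \<and> s i \<le> e" for i using r e \<delta> \<beta>_pos by (auto simp: s_def)
    show "A \<subseteq> (\<Union>i. dball d (p i) (s i))" using cover by (fastforce simp: s_def)
  qed
  also have "\<dots> \<le> (\<Sum>i. (if i \<in> K then ennreal (\<beta> * (r i)\<^sup>2) else 0) + ennreal (\<delta> * (1/2) ^ Suc i))"
  proof (intro suminf_le allI)
    fix i
    have "\<beta> * (min e (sqrt (\<delta> * (1/2) ^ Suc i / \<beta>)))\<^sup>2 \<le> \<beta> * (sqrt (\<delta> * (1/2) ^ Suc i / \<beta>))\<^sup>2"
      using e \<delta> \<beta>_pos by (intro mult_left_mono power_mono) auto
    also have "\<dots> = \<delta> * (1/2) ^ Suc i" using \<delta> \<beta>_pos by simp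
    finally show "ennreal (\<beta> * (s i)\<^sup>2)
        \<le> (if i \<in> K then ennreal (\<beta> * (r i)\<^sup>2) else 0) + ennreal (\<delta> * (1/2) ^ Suc i)"
      using ennreal_leI by (auto simp: s_def)
  qed auto
  also have "\<dots> = (\<Sum>i. if i \<in> K then ennreal (\<beta> * (r i)\<^sup>2) else 0) + (\<Sum>i. ennreal (\<delta> * (1/2) ^ Suc i))"
    by (rule suminf_add[symmetric]) auto
  also have "(\<Sum>i. ennreal (\<delta> * (1/2) ^ Suc i)) = ennreal \<delta>" using \<delta> by (intro suminf_half_powers) simp
  finally show "sph_eps d e A \<le> (\<Sum>i. if i \<in> K then ennreal (\<beta> * (r i)\<^sup>2) else 0) + ennreal \<delta>" .
qed

lemma sph_eps_le_finite:
  fixes n :: nat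
  assumes e: "0 < e" and r: "\<And>i. i < n \<Longrightarrow> 0 < r i \<and> r i \<le> e"
    and cover: "A \<subseteq> (\<Union>i<n. dball d (p i) (r i))"
  shows "sph_eps d e A \<le> ennreal (\<Sum>i<n. \<beta> * (r i)\<^sup>2)"
proof -
  have "sph_eps d e A \<le> (\<Sum>i. if i \<in> {..<n} then ennreal (\<beta> * (r i)\<^sup>2) else 0)"
    using assms by (intro sph_eps_le_family) auto
  also have "\<dots> = (\<Sum>i<n. ennreal (\<beta> * (r i)\<^sup>2))"
    by (subst suminf_finite[of "{..<n}"]) auto
  also have "\<dots> = ennreal (\<Sum>i<n. \<beta> * (r i)\<^sup>2)" using \<beta>_pos by (intro sum_ennreal) auto
  finally show ?thesis .
qed

lemma sph_eps_empty [simp]: "0 < e \<Longrightarrow> sph_eps d e {} = 0"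
  using sph_eps_le_finite[of e 0 "\<lambda>_. e" "{}"] by simp

lemma sph_eps_mono: "A \<subseteq> B \<Longrightarrow> sph_eps d e A \<le> sph_eps d e B"
  unfolding sph_eps_def by (intro INF_superset_mono) auto

lemma sph_eps_antimono: "e \<le> e' \<Longrightarrow> sph_eps d e' A \<le> sph_eps d e A"
  unfolding sph_eps_def by (intro INF_superset_mono) (auto intro: order_trans)

lemma sph_eps_countably_subadditive:
  fixes A :: "nat \<Rightarrow> heis set"
  assumes e: "0 < e"
  shows "sph_eps d e (\<Union>n. A n) \<le> (\<Sum>n. sph_eps d e (A n))"
proof (rule ennreal_le_epsilon)
  fix \<delta> :: real assume fin: "(\<Sum>n. sph_eps d e (A n)) < top" and \<delta>: "\<delta> > 0"
  have less: "sph_eps d e (A n) < sph_eps d e (A n) + ennreal (\<delta> * (1/2) ^ Suc n)" for n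
  proof -
    have "sph_eps d e (A n) \<noteq> top"
      using ennreal_suminf_lessD[OF fin] by (simp add: less_top)
    then show ?thesis using \<delta> ennreal_add_left_cancel_less[of "sph_eps d e (A n)" 0] by simp
  qed
  have "\<forall>n. \<exists>pr. (\<forall>i::nat. 0 < snd pr i \<and> snd pr i \<le> e) \<and> A n \<subseteq> (\<Union>i. dball d (fst pr i) (snd pr i)) \<and>
    (\<Sum>i. ennreal (\<beta> * (snd pr i)\<^sup>2)) < sph_eps d e (A n) + ennreal (\<delta> * (1/2) ^ Suc n)"
  proof
    fix n
    obtain p r where "\<And>i::nat. 0 < r i \<and> r i \<le> e" "A n \<subseteq> (\<Union>i. dball d (p i) (r i))"
      "(\<Sum>i. ennreal (\<beta> * (r i)\<^sup>2)) < sph_eps d e (A n) + ennreal (\<delta> * (1/2) ^ Suc n)"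
      using less[of n] by (rule sph_eps_lessE) blast
    then show "\<exists>pr. (\<forall>i::nat. 0 < snd pr i \<and> snd pr i \<le> e) \<and> A n \<subseteq> (\<Union>i. dball d (fst pr i) (snd pr i)) \<and>
      (\<Sum>i. ennreal (\<beta> * (snd pr i)\<^sup>2)) < sph_eps d e (A n) + ennreal (\<delta> * (1/2) ^ Suc n)"
      by (intro exI[of _ "(p, r)"]) simp
  qed
  from choice[OF this] obtain pr where
    pr: "\<forall>n. (\<forall>i::nat. 0 < snd (pr n) i \<and> snd (pr n) i \<le> e) \<and>
      A n \<subseteq> (\<Union>i. dball d (fst (pr n) i) (snd (pr n) i)) \<and>
      (\<Sum>i. ennreal (\<beta> * (snd (pr n) i)\<^sup>2)) < sph_eps d e (A n) + ennreal (\<delta> * (1/2) ^ Suc n)" ..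
  define p r where "p n = fst (pr n)" and "r n = snd (pr n)" for n
  have r: "0 < r n i \<and> r n i \<le> e"
    and cover: "A n \<subseteq> (\<Union>i. dball d (p n i) (r n i))"
    and cost: "(\<Sum>i. ennreal (\<beta> * (r n i)\<^sup>2)) < sph_eps d e (A n) + ennreal (\<delta> * (1/2) ^ Suc n)" for n i
    using pr by (simp_all add: p_def r_def)
  have "sph_eps d e (\<Union>n. A n) \<le> (\<Sum>k. ennreal (\<beta> * (case_prod r (prod_decode k))\<^sup>2))"
  proof (rule sph_eps_le)
    show "0 < case_prod r (prod_decode k) \<and> case_prod r (prod_decode k) \<le> e" for k
      using r by (simp add: split_beta)
    show "(\<Union>n. A n) \<subseteq> (\<Union>k. dball d (case_prod p (prod_decode k)) (case_prod r (prod_decode k)))"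
    proof clarify
      fix x n assume "x \<in> A n"
      then obtain i where "x \<in> dball d (p n i) (r n i)" using cover by blast
      then show "x \<in> (\<Union>k. dball d (case_prod p (prod_decode k)) (case_prod r (prod_decode k)))"
        by (intro UN_I[of "prod_encode (n, i)"]) auto
    qed
  qed
  also have "\<dots> = (\<Sum>n. \<Sum>i. ennreal (\<beta> * (r n i)\<^sup>2))"
    using suminf_ennreal_2dimen[of _ "\<lambda>(n, i). ennreal (\<beta> * (r n i)\<^sup>2)"] by (simp add: split_beta)
  also have "\<dots> \<le> (\<Sum>n. sph_eps d e (A n) + ennreal (\<delta> * (1/2) ^ Suc n))"
    by (intro suminf_le allI less_imp_le cost) auto
  also have "\<dots> = (\<Sum>n. sph_eps d e (A n)) + (\<Sum>n. ennreal (\<delta> * (1/2) ^ Suc n))"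
    by (rule suminf_add[symmetric]) auto
  also have "(\<Sum>n. ennreal (\<delta> * (1/2) ^ Suc n)) = ennreal \<delta>" using \<delta> by (intro suminf_half_powers) simp
  finally show "sph_eps d e (\<Union>n. A n) \<le> (\<Sum>n. sph_eps d e (A n)) + ennreal \<delta>" .
qed

text \<open>Two points of a ball of radius at most e are less than 2e apart, so no ball meets both
  sets and every cover of the union splits into disjoint subfamilies covering \<open>A\<close> and
  \<open>B\<close>.\<close>

lemma sph_eps_separated:
  assumes e: "0 < e" and sep: "\<And>x y. x \<in> A \<Longrightarrow> y \<in> B \<Longrightarrow> 2 * e \<le> d x y"
  shows "sph_eps d e A + sph_eps d e B \<le> sph_eps d e (A \<union> B)"
proof (rule ccontr)
  assume "\<not> ?thesis"
  then have "sph_eps d e (A \<union> B) < sph_eps d e A + sph_eps d e B" by simp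
  then obtain p r where r: "\<And>i::nat. 0 < r i \<and> r i \<le> e"
    and cover: "A \<union> B \<subseteq> (\<Union>i. dball d (p i) (r i))"
    and cost: "(\<Sum>i. ennreal (\<beta> * (r i)\<^sup>2)) < sph_eps d e A + sph_eps d e B"
    by (rule sph_eps_lessE) blast
  define K where "K S = {i. dball d (p i) (r i) \<inter> S \<noteq> {}}" for S
  have le: "sph_eps d e S \<le> (\<Sum>i. if i \<in> K S then ennreal (\<beta> * (r i)\<^sup>2) else 0)"
    if S: "S \<subseteq> A \<union> B" for S
  proof (rule sph_eps_le_family[OF e])
    show "0 < r i \<and> r i \<le> e" for i by (rule r)
    show "S \<subseteq> (\<Union>i\<in>K S. dball d (p i) (r i))"
    proof
      fix x assume x: "x \<in> S"
      then obtain i where "x \<in> dball d (p i) (r i)" using cover S by blast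
      then show "x \<in> (\<Union>i\<in>K S. dball d (p i) (r i))" using x by (auto simp: K_def)
    qed
  qed
  have disj: "K A \<inter> K B = {}"
  proof (rule equals0I)
    fix i assume "i \<in> K A \<inter> K B"
    then obtain x y where "x \<in> A" "y \<in> B" and xy: "d (p i) x < r i" "d (p i) y < r i"
      by (auto simp: K_def dball_def)
    then have "2 * e \<le> d x y" by (intro sep)
    then show False using xy r[of i] d_triangle[of x y "p i"] d_sym[of x "p i"] by linarith
  qed
  have "sph_eps d e A + sph_eps d e B \<le>
    (\<Sum>i. if i \<in> K A then ennreal (\<beta> * (r i)\<^sup>2) else 0) + (\<Sum>i. if i \<in> K B then ennreal (\<beta> * (r i)\<^sup>2) else 0)"
    by (intro add_mono le) auto
  also have "\<dots> = (\<Sum>i. (if i \<in> K A then ennreal (\<beta> * (r i)\<^sup>2) else 0) + (if i \<in> K B then ennreal (\<beta> * (r i)\<^sup>2) else 0))"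
    by (rule suminf_add) auto
  also have "\<dots> \<le> (\<Sum>i. ennreal (\<beta> * (r i)\<^sup>2))"
    using disj by (intro suminf_le allI) auto
  finally show False using cost by simp
qed

lemma sph_eps_le_sph2: "0 < e \<Longrightarrow> sph_eps d e A \<le> sph2 d A"
  unfolding sph2_def by (intro SUP_upper) simp

lemma sph2_le: "(\<And>e. 0 < e \<Longrightarrow> sph_eps d e A \<le> x) \<Longrightarrow> sph2 d A \<le> x"
  unfolding sph2_def by (intro SUP_least) simp

lemma sph2_mono: "A \<subseteq> B \<Longrightarrow> sph2 d A \<le> sph2 d B"
  unfolding sph2_def by (intro SUP_mono') (rule sph_eps_mono)

lemma measure_space_sph2: "measure_space UNIV (sets borel) (sph2 d)"
proof (rule metric_outer_measure_space_borel[where m = d])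
  show "d x z \<le> d x y + d y z" for x y z by (rule d_triangle)
  show "sph2 d {} = 0" using sph2_le[of "{}" 0] by simp
  show "sph2 d A \<le> sph2 d B" if "A \<subseteq> B" for A B using that by (rule sph2_mono)
  show "sph2 d (\<Union>i. A i) \<le> (\<Sum>i. sph2 d (A i))" for A :: "nat \<Rightarrow> heis set"
  proof (rule sph2_le)
    fix e :: real assume e: "0 < e"
    have "sph_eps d e (\<Union>i. A i) \<le> (\<Sum>i. sph_eps d e (A i))"
      using e by (rule sph_eps_countably_subadditive)
    also have "\<dots> \<le> (\<Sum>i. sph2 d (A i))" using e by (intro suminf_le sph_eps_le_sph2 allI) auto
    finally show "sph_eps d e (\<Union>i. A i) \<le> (\<Sum>i. sph2 d (A i))" .
  qed
  show "sph2 d A + sph2 d B \<le> sph2 d (A \<union> B)"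
    if e: "e > 0" and sep: "\<And>x y. x \<in> A \<Longrightarrow> y \<in> B \<Longrightarrow> e \<le> d x y" for A B e
  proof -
    \<comment> \<open>The two suprema over scales are independent, so the bound is needed for two
      different scales; both terms increase on passing to a common smaller scale, chosen at most e/2
      for the separation.\<close>
    have "sph_eps d e1 A + sph_eps d e2 B \<le> sph2 d (A \<union> B)" if "e1 > 0" "e2 > 0" for e1 e2
    proof -
      define e3 where "e3 = min (e / 2) (min e1 e2)"
      have e3: "e3 > 0" "e3 \<le> e1" "e3 \<le> e2" "2 * e3 \<le> e" using e that by (auto simp: e3_def)
      have "sph_eps d e1 A + sph_eps d e2 B \<le> sph_eps d e3 A + sph_eps d e3 B"
        using e3 by (intro add_mono sph_eps_antimono)
      also have "\<dots> \<le> sph_eps d e3 (A \<union> B)"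
        using e3 sep by (intro sph_eps_separated) (auto intro: order_trans)
      also have "\<dots> \<le> sph2 d (A \<union> B)" using e3 by (intro sph_eps_le_sph2)
      finally show ?thesis .
    qed
    then show ?thesis unfolding sph2_def[of d A] sph2_def[of d B]
      by (subst ennreal_SUP_add_left[symmetric], simp, intro SUP_least,
          subst ennreal_SUP_add_right, simp, intro SUP_least) auto
  qed
  show "\<exists>e>0. {y. d x y < e} \<subseteq> G" if "open G" "x \<in> G" for G x
    using open_contains_dball[OF that] by (metis dball_def)
qed

lemma space_sph2_measure [simp]: "space (sph2_measure d) = UNIV"
  and sets_sph2_measure [simp, measurable_cong]: "sets (sph2_measure d) = sets borel"
  using sets.sigma_sets_eq[of "borel :: heis measure"] 
  by (simp_all add: sph2_measure_def space_measure_of_conv)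

text \<open>\<open>measure_of\<close> returns the zero set function unless its argument is countably
  additive on the generated sigma-algebra, so this identity rests on
  \<open>measure_space_sph2\<close>.\<close>

lemma emeasure_sph2_measure: "U \<in> sets borel \<Longrightarrow> emeasure (sph2_measure d) U = sph2 d U"
  unfolding sph2_measure_def using measure_space_sph2 sets.sigma_sets_eq[of "borel :: heis measure"]
  by (intro emeasure_measure_of_sigma) (auto simp: measure_space_def)

end

section \<open>Upper bound along a curve\<close>

lemma equal_subdivision:
  fixes a h t :: real
  shows "n > 0 \<Longrightarrow> a \<le> t \<Longrightarrow> t \<le> a + real n * h \<Longrightarrow> \<exists>i<n. a + real i * h \<le> t \<and> t \<le> a + real i * h + h"
proof (induction n)
  case (Suc n)
  show ?case
  proof (cases "n > 0 \<and> t \<le> a + real n * h")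
    case True
    then show ?thesis using Suc by (meson less_Suc_eq)
  next
    case False
    then show ?thesis using Suc.prems by (intro exI[of _ n]) (auto simp: algebra_simps)
  qed
qed simp

lemma mean_value:
  fixes P :: "real \<Rightarrow> real"
  assumes "\<And>t. (P has_real_derivative \<theta> t) (at t)"
  obtains \<xi> where "min s t \<le> \<xi>" "\<xi> \<le> max s t" "P t - P s = (t - s) * \<theta> \<xi>"
proof -
  consider "s < t" | "s = t" | "t < s" by linarith
  then show ?thesis
  proof cases
    case 1
    then obtain z where "s < z" "z < t" "P t - P s = (t - s) * \<theta> z"
      using MVT2[of s t P \<theta>] assms by blast
    then show ?thesis using that[of z] by simp
  next
    case 2
    then show ?thesis using that[of s] by simp
  next
    case 3
    then obtain z where "t < z" "z < s" "P s - P t = (s - t) * \<theta> z"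
      using MVT2[of t s P \<theta>] assms by blast
    then show ?thesis using that[of z] by (simp add: algebra_simps)
  qed
qed

text \<open>The hypotheses on a nondegenerate compact interval, with the integral replaced by
  increments of a primitive \<open>P\<close>. Having \<open>P\<close> and \<open>\<theta>\<close> on
  the whole line avoids one-sided derivatives at the end points.\<close>

locale vertical_curve = homogeneous_distance +
  fixes \<gamma> :: "real \<Rightarrow> heis" and P \<theta> \<omega> :: "real \<Rightarrow> real" and a b :: real
  assumes ab: "a < b"
    and inj: "inj_on \<gamma> {a..b}"
    and P: "\<And>t. (P has_real_derivative \<theta> t) (at t)"
    and \<theta>: "continuous_on UNIV \<theta>"
    and \<omega>_nonneg: "\<And>t. 0 \<le> t \<Longrightarrow> 0 \<le> \<omega> t"
    and \<omega>_mono: "\<And>s t. 0 \<le> s \<Longrightarrow> s \<le> t \<Longrightarrow> \<omega> s \<le> \<omega> t"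
    and \<omega>_lim: "(\<omega> \<longlongrightarrow> 0) (at_right 0)"
    and horiz: "\<And>s t. s \<in> {a..b} \<Longrightarrow> t \<in> {a..b} \<Longrightarrow>
        hnorm (hmul (hinv (\<gamma> s)) (\<gamma> t)) \<le> sqrt (\<bar>t - s\<bar> * \<omega> \<bar>t - s\<bar>)"
    and vertical: "\<And>s t. s \<in> {a..b} \<Longrightarrow> t \<in> {a..b} \<Longrightarrow>
        \<bar>vert (hmul (hinv (\<gamma> s)) (\<gamma> t)) - (P t - P s)\<bar> \<le> \<bar>t - s\<bar> * \<omega> \<bar>t - s\<bar>"
begin

text \<open>The vertical element is central, so multiplying the increment by its inverse only shifts
  the height. The two hypotheses then bound the horizontal norm and the square root of the height by
  the same quantity, whence the constant 2C.\<close>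

lemma vertical_approx:
  obtains C where "C > 0" "\<And>s t. s \<in> {a..b} \<Longrightarrow> t \<in> {a..b} \<Longrightarrow>
    d (\<gamma> t) (hmul (\<gamma> s) (0, 0, P t - P s)) \<le> C * sqrt (\<bar>t - s\<bar> * \<omega> \<bar>t - s\<bar>)"
proof -
  obtain C where C: "C > 0" "\<And>x. N x \<le> C * (hnorm x + sqrt \<bar>vert x\<bar>)" by (rule N_upper) blast
  have "d (\<gamma> t) (hmul (\<gamma> s) (0, 0, P t - P s)) \<le> (2 * C) * sqrt (\<bar>t - s\<bar> * \<omega> \<bar>t - s\<bar>)"
    if st: "s \<in> {a..b}" "t \<in> {a..b}" for s t
  proof -
    define w where "w = hmul (hinv (\<gamma> s)) (\<gamma> t)"
    define T where "T = P t - P s"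
    define v where "v = hmul (0, 0, - T) w"
    have "\<gamma> t = hmul (\<gamma> s) w" by (simp add: w_def)
    then have "d (\<gamma> t) (hmul (\<gamma> s) (0, 0, T)) = d (0, 0, T) w"
      by (simp add: d_left d_sym)
    also have "\<dots> = N v" by (simp add: d_eq_N v_def hinv_def)
    also have "\<dots> \<le> C * (hnorm v + sqrt \<bar>vert v\<bar>)" by (rule C)
    also have "hnorm v = hnorm w" by (simp add: v_def heis_ops)
    also have "vert v = vert w - T" by (simp add: v_def heis_ops)
    also have "C * (hnorm w + sqrt \<bar>vert w - T\<bar>) \<le> C * (sqrt (\<bar>t - s\<bar> * \<omega> \<bar>t - s\<bar>) + sqrt (\<bar>t - s\<bar> * \<omega> \<bar>t - s\<bar>))"
      using C horiz[OF st] vertical[OF st]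
      by (intro mult_left_mono add_mono real_sqrt_le_mono) (auto simp: w_def T_def)
    finally show ?thesis by (simp add: T_def)
  qed
  then show ?thesis using that[of "2 * C"] C by simp
qed

lemma continuous_P: "continuous_on S P"
  using P by (meson DERIV_isCont continuous_at_imp_continuous_on)

lemma continuous_\<gamma>: "continuous_on {a..b} \<gamma>"
  unfolding continuous_on_def
proof (intro ballI topological_tendstoI)
  fix s and G :: "heis set" assume s: "s \<in> {a..b}" and "open G" "\<gamma> s \<in> G"
  then obtain r where r: "r > 0" "dball d (\<gamma> s) r \<subseteq> G" by (metis open_contains_dball)
  obtain C where C: "C > 0" "\<And>s t. s \<in> {a..b} \<Longrightarrow> t \<in> {a..b} \<Longrightarrow>
    d (\<gamma> t) (hmul (\<gamma> s) (0, 0, P t - P s)) \<le> C * sqrt (\<bar>t - s\<bar> * \<omega> \<bar>t - s\<bar>)"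
    by (rule vertical_approx) blast
  \<comment> \<open>\<open>\<omega>\<close> may jump, so it is frozen at its largest value on the
    interval; the factor |t - s| alone drives the bound to 0.\<close>
  let ?g = "\<lambda>t. C * sqrt (\<bar>t - s\<bar> * \<omega> (b - a)) + N (0, 0, P t - P s)"
  have "continuous_on {a..b} ?g"
    by (intro continuous_intros continuous_P continuous_on_compose2[OF continuous_N]) auto
  then have "(?g \<longlongrightarrow> ?g s) (at s within {a..b})" using s unfolding continuous_on_def by blast
  moreover have "N (0, 0, 0) = 0" by (simp add: zero_prod_def)
  ultimately have "(?g \<longlongrightarrow> 0) (at s within {a..b})" by simp
  then have "eventually (\<lambda>t. ?g t < r) (at s within {a..b})" using r by (simp add: order_tendstoD)
  moreover have "eventually (\<lambda>t. t \<in> {a..b}) (at s within {a..b})"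
    by (simp add: eventually_at_filter)
  ultimately show "eventually (\<lambda>t. \<gamma> t \<in> G) (at s within {a..b})"
  proof eventually_elim
    case (elim t)
    have "d (\<gamma> s) (\<gamma> t) \<le> d (\<gamma> s) (hmul (\<gamma> s) (0, 0, P t - P s)) + d (hmul (\<gamma> s) (0, 0, P t - P s)) (\<gamma> t)"
      by (rule d_triangle)
    also have "d (\<gamma> s) (hmul (\<gamma> s) (0, 0, P t - P s)) = N (0, 0, P t - P s)"
      by (simp add: d_eq_N)
    also have "d (hmul (\<gamma> s) (0, 0, P t - P s)) (\<gamma> t) \<le> C * sqrt (\<bar>t - s\<bar> * \<omega> \<bar>t - s\<bar>)"
      using C(2)[OF s elim(2)] by (simp add: d_sym)
    also have "\<dots> \<le> C * sqrt (\<bar>t - s\<bar> * \<omega> (b - a))"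
      using C s elim(2) by (intro mult_left_mono real_sqrt_le_mono \<omega>_mono) auto
    finally have "d (\<gamma> s) (\<gamma> t) < r" using elim(1) by linarith
    then show ?case using r by (auto simp: dball_def)
  qed
qed

lemma \<omega>_small:
  assumes "\<eta> > 0"
  obtains \<rho> where "\<rho> > 0" "\<And>h. 0 < h \<Longrightarrow> h \<le> \<rho> \<Longrightarrow> \<omega> h \<le> \<eta>"
proof -
  have "eventually (\<lambda>h. \<omega> h < \<eta>) (at_right 0)" using \<omega>_lim assms by (rule order_tendstoD)
  then obtain r where r: "r > 0" "\<And>h. 0 < h \<Longrightarrow> h < r \<Longrightarrow> \<omega> h < \<eta>"
    by (auto simp: eventually_at_right_field)
  show ?thesis
  proof (rule that[of "r / 2"])
    show "\<omega> h \<le> \<eta>" if "0 < h" "h \<le> r / 2" for h using r(2)[of h] that r(1) by fastforce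
  qed (use r in simp)
qed

lemma \<theta>_oscillation:
  assumes "\<eta> > 0"
  obtains \<rho> where "\<rho> > 0"
    "\<And>s t. s \<in> {a..b} \<Longrightarrow> t \<in> {a..b} \<Longrightarrow> \<bar>s - t\<bar> \<le> \<rho> \<Longrightarrow> \<bar>\<theta> s - \<theta> t\<bar> \<le> \<eta>"
proof -
  have "uniformly_continuous_on {a..b} \<theta>"
    by (intro compact_uniformly_continuous continuous_on_subset[OF \<theta>]) auto
  then obtain r where r: "r > 0" "\<And>s t. s \<in> {a..b} \<Longrightarrow> t \<in> {a..b} \<Longrightarrow> dist t s < r \<Longrightarrow> dist (\<theta> t) (\<theta> s) < \<eta>"
    using assms unfolding uniformly_continuous_on_def by metis
  show ?thesis
  proof (rule that[of "r / 2"])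
    show "\<bar>\<theta> s - \<theta> t\<bar> \<le> \<eta>" if "s \<in> {a..b}" "t \<in> {a..b}" "\<bar>s - t\<bar> \<le> r / 2" for s t
      using r(2)[of t s] that r(1) by (simp add: dist_real_def)
  qed (use r in simp)
qed

text \<open>Dilation by r turns the section [\<alpha>, \<alpha> + l] of the unit ball at y into r^2
  [\<alpha>, \<alpha> + l]. The central translation by m - r^2 \<alpha> makes it start at m, and
  left translation by q carries it to the vertical line through q.\<close>

lemma vertical_cover:
  assumes r: "r > 0" and t: "0 \<le> T - m" "T - m \<le> l * r\<^sup>2"
    and y: "\<And>\<sigma>. \<alpha> \<le> \<sigma> \<Longrightarrow> \<sigma> \<le> \<alpha> + l \<Longrightarrow> d y (0, 0, \<sigma>) < 1"
  shows "d (hmul q (hmul (0, 0, m - r\<^sup>2 * \<alpha>) (hdil r y))) (hmul q (0, 0, T)) < r"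
proof -
  define v where "v = T - m + r\<^sup>2 * \<alpha>"
  have "(0, 0, T) = hmul (0, 0, m - r\<^sup>2 * \<alpha>) (0, 0, v)" by (simp add: hmul_def v_def)
  then have "d (hmul q (hmul (0, 0, m - r\<^sup>2 * \<alpha>) (hdil r y))) (hmul q (0, 0, T)) = d (hdil r y) (0, 0, v)"
    by (simp add: d_left)
  also have "\<dots> = r * d y (0, 0, v / r\<^sup>2)" using r by (rule d_vertical_scale)
  also have "d y (0, 0, v / r\<^sup>2) < 1"
    using r t by (intro y) (simp_all add: v_def field_simps)
  finally show ?thesis using r by (simp add: mult_strict_left_mono)
qed

text \<open>The cube collects one factor 1 + \<kappa> from l = \<beta> / (1 + \<kappa>) and two from
  enlarging the radii by 1 + \<kappa>, which absorbs the distance from the curve to the vertical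
  segment. Of the term 3\<kappa>, two parts are the margins for the oscillation of \<theta> below
  and above, and one pays for replacing |\<theta>| at the node by its mean value over the
  step.\<close>

lemma sph_eps_upper:
  assumes Q: "\<And>t. (Q has_real_derivative \<bar>\<theta> t\<bar>) (at t)" and \<kappa>: "0 < \<kappa>" and e: "0 < e"
  shows "sph_eps d e (\<gamma> ` {a..b}) \<le> ennreal ((1 + \<kappa>)^3 * (Q b - Q a + 3 * \<kappa> * (b - a)))"
proof -
  define l where "l = \<beta> / (1 + \<kappa>)"
  have l: "0 < l" "l < \<beta>" using \<kappa> \<beta>_pos by (auto simp: l_def field_simps)
  obtain y \<alpha> where y: "\<And>\<sigma>. \<alpha> \<le> \<sigma> \<Longrightarrow> \<sigma> \<le> \<alpha> + l \<Longrightarrow> d y (0, 0, \<sigma>) < 1"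
    using long_section[OF l(2,1)] by blast
  obtain C where C: "C > 0" "\<And>s t. s \<in> {a..b} \<Longrightarrow> t \<in> {a..b} \<Longrightarrow>
    d (\<gamma> t) (hmul (\<gamma> s) (0, 0, P t - P s)) \<le> C * sqrt (\<bar>t - s\<bar> * \<omega> \<bar>t - s\<bar>)"
    by (rule vertical_approx) blast
  obtain \<rho>1 where \<rho>1: "\<rho>1 > 0"
    "\<And>s t. s \<in> {a..b} \<Longrightarrow> t \<in> {a..b} \<Longrightarrow> \<bar>s - t\<bar> \<le> \<rho>1 \<Longrightarrow> \<bar>\<theta> s - \<theta> t\<bar> \<le> \<kappa>"
    by (rule \<theta>_oscillation[OF \<kappa>]) blast
  \<comment> \<open>With this \<eta> the squared displacement C^2 h \<eta> equals \<kappa>^2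
    (\<kappa> h / l), which is at most (\<kappa> r)^2 because r^2 >= 2 \<kappa> h / l.\<close>
  define \<eta> where "\<eta> = \<kappa>^3 / (C\<^sup>2 * l)"
  have \<eta>: "\<eta> > 0" using \<kappa> C l by (simp add: \<eta>_def)
  obtain \<rho>2 where \<rho>2: "\<rho>2 > 0" "\<And>h. 0 < h \<Longrightarrow> h \<le> \<rho>2 \<Longrightarrow> \<omega> h \<le> \<eta>"
    by (rule \<omega>_small[OF \<eta>]) blast
  have "compact ((\<lambda>t. \<bar>\<theta> t\<bar>) ` {a..b})"
    by (intro compact_continuous_image continuous_intros continuous_on_subset[OF \<theta>]) auto
  then obtain M where "\<forall>x\<in>(\<lambda>t. \<bar>\<theta> t\<bar>) ` {a..b}. norm x \<le> M"
    using compact_imp_bounded bounded_iff by metis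
  then have M: "\<bar>\<theta> t\<bar> \<le> M" if "t \<in> {a..b}" for t using that by auto
  have M0: "M \<ge> 0" using M[of a] ab by auto
  \<comment> \<open>A step h <= \<rho>3 keeps the enlarged radii (1 + \<kappa>) r at most e, since
    |\<theta>| <= M.\<close>
  define \<rho>3 where "\<rho>3 = e\<^sup>2 * l / ((1 + \<kappa>)\<^sup>2 * (M + 2 * \<kappa>))"
  have \<rho>3: "\<rho>3 > 0" using e l \<kappa> M0 by (simp add: \<rho>3_def)
  define \<rho> where "\<rho> = min \<rho>1 (min \<rho>2 \<rho>3)"
  have \<rho>: "\<rho> > 0" using \<rho>1 \<rho>2 \<rho>3 by (simp add: \<rho>_def)
  obtain n :: nat where n: "(b - a) / \<rho> < real n" using reals_Archimedean2 by blast
  have n0: "n > 0" using n \<rho> ab by (metis diff_gt_0_iff_gt divide_pos_pos less_trans of_nat_0_less_iff)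
  define h where "h = (b - a) / real n"
  have h: "h > 0" "real n * h = b - a" using n0 ab by (simp_all add: h_def)
  have "h \<le> \<rho>" using n n0 \<rho> by (simp add: h_def field_simps)
  then have h\<rho>: "h \<le> \<rho>1" "h \<le> \<rho>2" "h \<le> \<rho>3" by (simp_all add: \<rho>_def)
  define \<tau> where "\<tau> i = a + real i * h" for i
  have \<tau>: "\<tau> i \<in> {a..b}" if "i \<le> n" for i
  proof -
    have "real i * h \<le> real n * h" using that h by (intro mult_right_mono) auto
    then show ?thesis using h by (simp add: \<tau>_def)
  qed
  \<comment> \<open>Chosen so that l r^2 = h (|\<theta>| + 2\<kappa>), the width of the range of
    possible increments of \<open>P\<close> in one step; the margin 2\<kappa> also keeps r positive
    at zeros of \<theta>.\<close>
  define r where "r i = sqrt ((\<bar>\<theta> (\<tau> i)\<bar> + 2 * \<kappa>) * h / l)" for i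
  have r2: "(r i)\<^sup>2 = (\<bar>\<theta> (\<tau> i)\<bar> + 2 * \<kappa>) * h / l" for i using \<kappa> h l by (simp add: r_def)
  have r0: "r i > 0" for i using \<kappa> h l by (simp add: r_def)
  \<comment> \<open>Increments of \<open>P\<close> from \<open>\<tau> i\<close> within the step lie in \<open>[m i, m i + l * (r i)\<^sup>2]\<close>.\<close>
  define m where "m i = h * (min 0 (\<theta> (\<tau> i)) - \<kappa>)" for i
  define p where "p i = hmul (\<gamma> (\<tau> i)) (hmul (0, 0, m i - (r i)\<^sup>2 * \<alpha>) (hdil (r i) y))" for i
  have cost: "sph_eps d e (\<gamma> ` {a..b}) \<le> ennreal (\<Sum>i<n. \<beta> * ((1 + \<kappa>) * r i)\<^sup>2)"
  proof (rule sph_eps_le_finite[OF e])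
    fix i assume i: "i < n"
    have "((1 + \<kappa>) * r i)\<^sup>2 = (1 + \<kappa>)\<^sup>2 * ((\<bar>\<theta> (\<tau> i)\<bar> + 2 * \<kappa>) * h / l)"
      by (simp add: power_mult_distrib r2)
    also have "\<dots> \<le> (1 + \<kappa>)\<^sup>2 * ((M + 2 * \<kappa>) * \<rho>3 / l)"
      using M[OF \<tau>, of i] i h h\<rho> l \<kappa> M0
      by (intro mult_left_mono divide_right_mono mult_mono) auto
    also have "\<dots> = e\<^sup>2"
    proof -
      have "X * (Y * (e\<^sup>2 * l / (X * Y)) / l) = e\<^sup>2" if "X > 0" "Y > 0" for X Y
        using that l by simp
      then show ?thesis using \<kappa> M0 unfolding \<rho>3_def by simp
    qed
    finally have "(1 + \<kappa>) * r i \<le> e" by (rule power2_le_imp_le) (use e in simp)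
    then show "0 < (1 + \<kappa>) * r i \<and> (1 + \<kappa>) * r i \<le> e" using \<kappa> r0 by simp
  next
    show "\<gamma> ` {a..b} \<subseteq> (\<Union>i<n. dball d (p i) ((1 + \<kappa>) * r i))"
    proof (rule image_subsetI)
      fix t assume t: "t \<in> {a..b}"
      then obtain i where i: "i < n" "\<tau> i \<le> t" "t \<le> \<tau> i + h"
        using equal_subdivision[OF n0, of a t h] h by (auto simp: \<tau>_def)
      have \<tau>i: "\<tau> i \<in> {a..b}" using \<tau> i by simp
      define T where "T = P t - P (\<tau> i)"
      define s where "s = t - \<tau> i"
      have s: "0 \<le> s" "s \<le> h" using i by (auto simp: s_def)
      obtain \<xi> where \<xi>: "min (\<tau> i) t \<le> \<xi>" "\<xi> \<le> max (\<tau> i) t" "T = s * \<theta> \<xi>"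
        unfolding T_def s_def by (rule mean_value[OF P]) blast
      have "\<bar>\<theta> \<xi> - \<theta> (\<tau> i)\<bar> \<le> \<kappa>"
        using \<xi> i t \<tau>i h\<rho> by (intro \<rho>1) auto
      then have lo: "min 0 (\<theta> (\<tau> i)) - \<kappa> \<le> \<theta> \<xi>" and hi: "\<theta> \<xi> \<le> max 0 (\<theta> (\<tau> i)) + \<kappa>" by auto
      \<comment> \<open>Since s runs through all of [0, h], the range must contain 0 as well; hence
        the minimum and maximum of \<theta> with 0.\<close>
      have "m i \<le> s * (min 0 (\<theta> (\<tau> i)) - \<kappa>)"
        unfolding m_def using s \<kappa> by (intro mult_right_mono_neg) auto
      also have "\<dots> \<le> T" unfolding \<xi> using lo s by (intro mult_left_mono)
      finally have 1: "0 \<le> T - m i" by simp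
      have "T \<le> s * (max 0 (\<theta> (\<tau> i)) + \<kappa>)" unfolding \<xi> using hi s by (intro mult_left_mono)
      also have "\<dots> \<le> h * (max 0 (\<theta> (\<tau> i)) + \<kappa>)" using s \<kappa> by (intro mult_right_mono) auto
      finally have "T - m i \<le> h * (max 0 (\<theta> (\<tau> i)) + \<kappa>) - m i" by simp
      also have "\<dots> = h * (\<bar>\<theta> (\<tau> i)\<bar> + 2 * \<kappa>)" by (auto simp: m_def algebra_simps max_def min_def)
      also have "\<dots> = l * (r i)\<^sup>2" using l by (simp add: r2)
      finally have 2: "T - m i \<le> l * (r i)\<^sup>2" .
      have A: "d (p i) (hmul (\<gamma> (\<tau> i)) (0, 0, T)) < r i"
        unfolding p_def by (rule vertical_cover[OF r0 1 2 y])
      have "s * \<omega> s \<le> h * \<eta>"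
      proof (cases "s = 0")
        case False
        then show ?thesis using s \<rho>2(2)[of s] h\<rho> \<omega>_nonneg[of s] by (intro mult_mono) auto
      qed (use h \<eta> in simp)
      then have "(C * sqrt (s * \<omega> s))\<^sup>2 \<le> C\<^sup>2 * (h * \<eta>)"
        using s \<omega>_nonneg[of s] by (simp add: power_mult_distrib mult_left_mono)
      also have "\<dots> = \<kappa>\<^sup>2 * (\<kappa> * h / l)"
        using C by (simp add: \<eta>_def power2_eq_square power3_eq_cube)
      also have "\<dots> \<le> \<kappa>\<^sup>2 * (r i)\<^sup>2"
        unfolding r2 using \<kappa> h l by (intro mult_left_mono divide_right_mono mult_right_mono) auto
      also have "\<dots> = (\<kappa> * r i)\<^sup>2" by (simp add: power_mult_distrib)
      finally have "C * sqrt (s * \<omega> s) \<le> \<kappa> * r i"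
        by (rule power2_le_imp_le) (use \<kappa> r0[of i] in simp)
      moreover have "d (\<gamma> t) (hmul (\<gamma> (\<tau> i)) (0, 0, T)) \<le> C * sqrt (s * \<omega> s)"
        using C(2)[OF \<tau>i t] s by (simp add: T_def s_def)
      ultimately have B: "d (\<gamma> t) (hmul (\<gamma> (\<tau> i)) (0, 0, T)) \<le> \<kappa> * r i" by linarith
      have "d (p i) (\<gamma> t) < (1 + \<kappa>) * r i"
        using d_triangle[of "p i" "\<gamma> t" "hmul (\<gamma> (\<tau> i)) (0, 0, T)"] A B
        by (simp add: d_sym[of _ "\<gamma> t"] algebra_simps)
      then show "\<gamma> t \<in> (\<Union>i<n. dball d (p i) ((1 + \<kappa>) * r i))"
        using i by (auto simp: dball_def)
    qed
  qed
  have "(\<Sum>i<n. \<beta> * ((1 + \<kappa>) * r i)\<^sup>2) \<le> (\<Sum>i<n. (1 + \<kappa>)^3 * ((Q (\<tau> (Suc i)) - Q (\<tau> i)) + 3 * \<kappa> * h))"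
  proof (rule sum_mono)
    fix i assume "i \<in> {..<n}"
    then have i: "\<tau> i \<in> {a..b}" "\<tau> (Suc i) \<in> {a..b}" using \<tau> by auto
    have \<tau>S: "\<tau> (Suc i) = \<tau> i + h" by (simp add: \<tau>_def algebra_simps)
    obtain \<xi> where \<xi>: "min (\<tau> i) (\<tau> (Suc i)) \<le> \<xi>" "\<xi> \<le> max (\<tau> i) (\<tau> (Suc i))"
      "Q (\<tau> (Suc i)) - Q (\<tau> i) = (\<tau> (Suc i) - \<tau> i) * \<bar>\<theta> \<xi>\<bar>"
      by (rule mean_value[OF Q]) blast
    have "\<bar>\<theta> \<xi> - \<theta> (\<tau> i)\<bar> \<le> \<kappa>"
      using \<xi> i \<tau>S h h\<rho> by (intro \<rho>1) auto
    then have "h * (\<bar>\<theta> (\<tau> i)\<bar> + 2 * \<kappa>) \<le> h * (\<bar>\<theta> \<xi>\<bar> + 3 * \<kappa>)" using h by (intro mult_left_mono) auto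
    then have le: "(\<bar>\<theta> (\<tau> i)\<bar> + 2 * \<kappa>) * h \<le> (Q (\<tau> (Suc i)) - Q (\<tau> i)) + 3 * \<kappa> * h"
      using \<xi>(3) by (simp add: \<tau>S algebra_simps)
    have "\<beta> * ((1 + \<kappa>) * r i)\<^sup>2 = (1 + \<kappa>)^3 * ((\<bar>\<theta> (\<tau> i)\<bar> + 2 * \<kappa>) * h)"
      using \<beta>_pos unfolding power_mult_distrib r2 l_def by (simp add: power2_eq_square power3_eq_cube)
    also have "\<dots> \<le> (1 + \<kappa>)^3 * ((Q (\<tau> (Suc i)) - Q (\<tau> i)) + 3 * \<kappa> * h)"
      using le \<kappa> by (intro mult_left_mono) auto
    finally show "\<beta> * ((1 + \<kappa>) * r i)\<^sup>2
        \<le> (1 + \<kappa>)^3 * ((Q (\<tau> (Suc i)) - Q (\<tau> i)) + 3 * \<kappa> * h)" .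
  qed
  also have "\<dots> = (1 + \<kappa>)^3 * ((\<Sum>i<n. Q (\<tau> (Suc i)) - Q (\<tau> i)) + real n * h * (3 * \<kappa>))"
    unfolding sum_distrib_left[symmetric] sum.distrib by simp
  also have "(\<Sum>i<n. Q (\<tau> (Suc i)) - Q (\<tau> i)) = Q b - Q a"
    using h by (subst sum_lessThan_telescope) (simp add: \<tau>_def)
  finally have "(\<Sum>i<n. \<beta> * ((1 + \<kappa>) * r i)\<^sup>2) \<le> (1 + \<kappa>)^3 * (Q b - Q a + 3 * \<kappa> * (b - a))"
    unfolding h(2) by (simp only: mult.commute)
  then show ?thesis by (rule order_trans[OF cost ennreal_leI])
qed

text \<open>The bound for \<kappa> holds at every scale e, so it passes to the supremum over scales
  before \<kappa> tends to 0.\<close>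

lemma sph2_upper:
  assumes Q: "\<And>t. (Q has_real_derivative \<bar>\<theta> t\<bar>) (at t)"
  shows "sph2 d (\<gamma> ` {a..b}) \<le> ennreal (Q b - Q a)"
proof -
  let ?f = "\<lambda>\<kappa>. (1 + \<kappa>)^3 * (Q b - Q a + 3 * \<kappa> * (b - a))"
  have "(?f \<longlongrightarrow> ?f 0) (at_right 0)" by (intro tendsto_intros)
  then have "((\<lambda>\<kappa>. ennreal (?f \<kappa>)) \<longlongrightarrow> ennreal (Q b - Q a)) (at_right 0)"
    by (intro tendsto_ennrealI) simp
  moreover have "eventually (\<lambda>\<kappa>. sph2 d (\<gamma> ` {a..b}) \<le> ennreal (?f \<kappa>)) (at_right 0)"
    unfolding eventually_at_filter
    by (intro always_eventually allI impI sph2_le sph_eps_upper[OF Q]) simp_all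
  ultimately show ?thesis by (rule tendsto_lowerbound) simp
qed

end

section \<open>Lower bound along a curve\<close>

text \<open>Change of variables by \<open>P\<close>, which is monotone on [u, v]. The substitution
  rule is applied to nondecreasing functions; for \<theta> <= 0 it is applied to c - P and the set
  -E, and Lebesgue measure is invariant under reflection. If u >= v, then S has at most one
  point.\<close>

lemma emeasure_density_le_monotone_image:
  fixes P \<theta> :: "real \<Rightarrow> real"
  assumes P: "\<And>t. (P has_real_derivative \<theta> t) (at t)" and \<theta>: "continuous_on UNIV \<theta>"
    and sign: "(\<forall>x\<in>{u..v}. 0 \<le> \<theta> x) \<or> (\<forall>x\<in>{u..v}. \<theta> x \<le> 0)"
    and E: "E \<in> sets borel" and S: "S \<in> sets borel" "S \<subseteq> {u..v}" "\<And>t. t \<in> S \<Longrightarrow> P t - c \<in> E"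
  shows "emeasure (density lborel (\<lambda>t. ennreal \<bar>\<theta> t\<bar>)) S \<le> emeasure lborel E"
proof (cases "u < v")
  case uv: True
  have *: "emeasure (density lborel (\<lambda>t. ennreal \<bar>f t\<bar>)) S \<le> emeasure lborel F"
    if R: "\<And>t. (R has_real_derivative f t) (at t)" and f: "continuous_on UNIV f"
      and pos: "\<forall>x\<in>{u..v}. 0 \<le> f x" and F: "F \<in> sets borel" "\<And>t. t \<in> S \<Longrightarrow> R t \<in> F" for f R F
  proof -
    have [measurable]: "f \<in> borel_measurable borel" using f by (rule borel_measurable_continuous_onI)
    note [measurable] = F(1) S(1)
    have "emeasure (density lborel (\<lambda>t. ennreal \<bar>f t\<bar>)) S = (\<integral>\<^sup>+t. ennreal \<bar>f t\<bar> * indicator S t \<partial>lborel)"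
      by (rule emeasure_density) auto
    also have "\<dots> \<le> (\<integral>\<^sup>+t. indicator F (R t) * ennreal (f t) * indicator {u..v} t \<partial>lborel)"
      using S pos F(2) by (intro nn_integral_mono) (auto simp: indicator_def subset_iff)
    also have "\<dots> = (\<integral>\<^sup>+s. indicator F s * indicator {R u..R v} s \<partial>lborel)"
      using uv pos by (intro nn_integral_substitution_aux[symmetric] R continuous_on_subset[OF f]) auto
    also have "\<dots> \<le> (\<integral>\<^sup>+s. indicator F s \<partial>lborel)"
      by (intro nn_integral_mono) (auto simp: indicator_def)
    also have "\<dots> = emeasure lborel F" by simp
    finally show ?thesis .
  qed
  show ?thesis using sign
  proof
    assume pos: "\<forall>x\<in>{u..v}. 0 \<le> \<theta> x"
    show ?thesis
      by (rule *[where R = "\<lambda>t. P t - c"]) (use P \<theta> pos E S in \<open>auto intro!: derivative_eq_intros\<close>)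
  next
    assume neg: "\<forall>x\<in>{u..v}. \<theta> x \<le> 0"
    have "emeasure (density lborel (\<lambda>t. ennreal \<bar>- \<theta> t\<bar>)) S \<le> emeasure lborel (uminus -` E)"
    proof (rule *[where R = "\<lambda>t. c - P t"])
      show "((\<lambda>t. c - P t) has_real_derivative - \<theta> t) (at t)" for t
        by (auto intro!: derivative_eq_intros P)
      show "continuous_on UNIV (\<lambda>t. - \<theta> t)" by (intro continuous_intros \<theta>)
      show "uminus -` E \<in> sets borel" using measurable_sets[OF borel_measurable_uminus[OF measurable_ident] E] by simp
    qed (use neg S in auto)
    also have "emeasure lborel (uminus -` E) = emeasure (distr lborel borel uminus) E"
      using E by (subst emeasure_distr) auto
    also have "\<dots> = emeasure lborel E" by (simp add: lborel_distr_uminus)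
    finally show ?thesis by simp
  qed
next
  case False
  then have "S \<subseteq> {u}" using S(2) by auto
  have [measurable]: "\<theta> \<in> borel_measurable borel" using \<theta> by (rule borel_measurable_continuous_onI)
  have "emeasure (density lborel (\<lambda>t. ennreal \<bar>\<theta> t\<bar>)) S \<le> emeasure (density lborel (\<lambda>t. ennreal \<bar>\<theta> t\<bar>)) {u}"
    using \<open>S \<subseteq> {u}\<close> by (rule emeasure_mono) auto
  also have "\<dots> = 0"
    using AE_lborel_singleton[of u]
    by (auto simp: emeasure_density nn_integral_0_iff_AE indicator_def elim: eventually_mono)
  finally show ?thesis by simp
qed

context vertical_curve
begin

definition \<nu> :: "real measure" where "\<nu> = density lborel (\<lambda>t. ennreal \<bar>\<theta> t\<bar>)"

lemma sets_\<nu> [simp, measurable_cong]: "sets \<nu> = sets borel"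
  by (simp add: \<nu>_def)

lemma \<theta>_borel [measurable]: "\<theta> \<in> borel_measurable borel"
  using \<theta> by (rule borel_measurable_continuous_onI)

lemma \<gamma>_vimage_borel:
  assumes "U \<in> sets borel"
  shows "{a..b} \<inter> \<gamma> -` U \<in> sets borel"
proof -
  have "\<gamma> \<in> borel_measurable (restrict_space borel {a..b})"
    by (intro borel_measurable_continuous_on_restrict continuous_\<gamma>)
  from measurable_sets[OF this assms] show ?thesis
    by (simp add: sets_restrict_space_iff space_restrict_space Int_commute)
qed

text \<open>Quantitative injectivity: the distance between \<gamma> s and \<gamma> t has a positive
  minimum over the compact set of pairs with |t - s| >= \<rho>.\<close>

lemma \<gamma>_separation:
  assumes \<rho>: "\<rho> > 0"
  obtains e where "e > 0" "\<And>s t. s \<in> {a..b} \<Longrightarrow> t \<in> {a..b} \<Longrightarrow> d (\<gamma> s) (\<gamma> t) < e \<Longrightarrow> \<bar>t - s\<bar> \<le> \<rho>"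
proof -
  define Z where "Z = ({a..b} \<times> {a..b}) \<inter> {p. \<rho> \<le> \<bar>snd p - fst p\<bar>}"
  have "closed {p :: real \<times> real. \<rho> \<le> \<bar>snd p - fst p\<bar>}"
    by (intro closed_Collect_le continuous_intros)
  then have Z: "compact Z" unfolding Z_def by (intro compact_Int_closed compact_Times) auto
  show ?thesis
  proof (cases "Z = {}")
    case True
    then show ?thesis using that[of 1] by (force simp: Z_def)
  next
    case False
    have "continuous_on Z (\<lambda>p. d (\<gamma> (fst p)) (\<gamma> (snd p)))"
      by (intro continuous_d continuous_on_compose2[OF continuous_\<gamma>] continuous_intros) (auto simp: Z_def)
    then obtain z where z: "z \<in> Z" "\<And>p. p \<in> Z \<Longrightarrow> d (\<gamma> (fst z)) (\<gamma> (snd z)) \<le> d (\<gamma> (fst p)) (\<gamma> (snd p))"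
      using continuous_attains_inf[OF Z False] by blast
    have "fst z \<in> {a..b}" "snd z \<in> {a..b}" "fst z \<noteq> snd z" using z(1) \<rho> by (auto simp: Z_def)
    then have "\<gamma> (fst z) \<noteq> \<gamma> (snd z)" using inj by (simp add: inj_on_eq_iff)
    then have "0 < d (\<gamma> (fst z)) (\<gamma> (snd z))" by (rule d_pos)
    moreover have "\<bar>t - s\<bar> \<le> \<rho>" if "s \<in> {a..b}" "t \<in> {a..b}" "d (\<gamma> s) (\<gamma> t) < d (\<gamma> (fst z)) (\<gamma> (snd z))" for s t
      using z(2)[of "(s, t)"] that by (force simp: Z_def)
    ultimately show ?thesis using that by blast
  qed
qed

text \<open>Localisation happens in two stages. Points of the ball are less than 2r apart, so
  separation first confines the parameters to a window of size \<rho> independent of r. There the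
  height grows at least linearly in |t - s|, whereas differences within the ball have height O(r^2);
  this improves the window to O(r^2), as the displacement estimate requires.\<close>

lemma ball_mass:
  assumes \<kappa>: "0 < \<kappa>"
  obtains e where "e > 0" "\<And>p r. 0 < r \<Longrightarrow> r \<le> e \<Longrightarrow>
    emeasure \<nu> {t \<in> {a..b}. \<kappa> \<le> \<bar>\<theta> t\<bar> \<and> \<gamma> t \<in> dball d p r} \<le> ennreal ((1 + \<kappa>)\<^sup>2 * (\<beta> * r\<^sup>2))"
proof -
  obtain C where C: "C > 0" "\<And>s t. s \<in> {a..b} \<Longrightarrow> t \<in> {a..b} \<Longrightarrow>
    d (\<gamma> t) (hmul (\<gamma> s) (0, 0, P t - P s)) \<le> C * sqrt (\<bar>t - s\<bar> * \<omega> \<bar>t - s\<bar>)"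
    by (rule vertical_approx) blast
  obtain K where K: "K > 0" "\<And>x. \<bar>vert x\<bar> \<le> K * (N x)\<^sup>2" by (rule vert_upper) blast
  \<comment> \<open>The first bound keeps the vertical error below h \<kappa>/4, half of the growth
    h \<kappa>/2 of |P t - P s|, which leaves h \<kappa>/4 <= 4 K r^2, that is h <= 16 K r^2 /
    \<kappa>. The second turns this into C^2 h \<omega>(h) <= (\<kappa> r)^2.\<close>
  define \<eta> where "\<eta> = min (\<kappa> / 4) (\<kappa>^3 / (16 * K * C\<^sup>2))"
  have \<eta>: "\<eta> > 0" "\<eta> \<le> \<kappa> / 4" "\<eta> \<le> \<kappa>^3 / (16 * K * C\<^sup>2)" using \<kappa> C K by (auto simp: \<eta>_def)
  obtain \<rho>1 where \<rho>1: "\<rho>1 > 0" "\<And>h. 0 < h \<Longrightarrow> h \<le> \<rho>1 \<Longrightarrow> \<omega> h \<le> \<eta>" by (rule \<omega>_small[OF \<eta>(1)]) blast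
  \<comment> \<open>With oscillation at most \<kappa>/2, \<theta> keeps its sign near s and stays at
    least \<kappa>/2 in absolute value.\<close>
  have "\<kappa> / 2 > 0" using \<kappa> by simp
  then obtain \<rho>2 where \<rho>2: "\<rho>2 > 0"
    "\<And>s t. s \<in> {a..b} \<Longrightarrow> t \<in> {a..b} \<Longrightarrow> \<bar>s - t\<bar> \<le> \<rho>2 \<Longrightarrow> \<bar>\<theta> s - \<theta> t\<bar> \<le> \<kappa> / 2"
    by (rule \<theta>_oscillation) blast
  define \<rho> where "\<rho> = min \<rho>1 \<rho>2"
  have \<rho>: "\<rho> > 0" "\<rho> \<le> \<rho>1" "\<rho> \<le> \<rho>2" using \<rho>1 \<rho>2 by (auto simp: \<rho>_def)
  obtain e where e: "e > 0" "\<And>s t. s \<in> {a..b} \<Longrightarrow> t \<in> {a..b} \<Longrightarrow> d (\<gamma> s) (\<gamma> t) < e \<Longrightarrow> \<bar>t - s\<bar> \<le> \<rho>"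
    by (rule \<gamma>_separation[OF \<rho>(1)]) blast
  have "emeasure \<nu> {t \<in> {a..b}. \<kappa> \<le> \<bar>\<theta> t\<bar> \<and> \<gamma> t \<in> dball d p r} \<le> ennreal ((1 + \<kappa>)\<^sup>2 * (\<beta> * r\<^sup>2))"
    if r: "0 < r" "r \<le> e / 2" for p r
  proof (cases "{t \<in> {a..b}. \<kappa> \<le> \<bar>\<theta> t\<bar> \<and> \<gamma> t \<in> dball d p r} = {}")
    case False
    define S where "S = {t \<in> {a..b}. \<kappa> \<le> \<bar>\<theta> t\<bar> \<and> \<gamma> t \<in> dball d p r}"
    obtain s where s: "s \<in> S" using False by (auto simp: S_def)
    have sab: "s \<in> {a..b}" and \<theta>s: "\<kappa> \<le> \<bar>\<theta> s\<bar>" and sp: "d p (\<gamma> s) < r"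
      using s by (auto simp: S_def dball_def)
    define R where "R = (1 + \<kappa>) * r"
    have R: "R > 0" "r \<le> R" using r \<kappa> by (simp_all add: R_def)
    \<comment> \<open>Translating by the inverse of \<gamma> s puts the vertical line through
      \<gamma> s on the axis; y is the centre of the translated ball, at distance less than r from
      the origin.\<close>
    define y where "y = hmul (hinv (\<gamma> s)) p"
    define u v where "u = max a (s - \<rho>)" and "v = min b (s + \<rho>)"
    have near: "\<bar>\<theta> s - \<theta> t\<bar> \<le> \<kappa> / 2" if "t \<in> {a..b}" "\<bar>t - s\<bar> \<le> \<rho>" for t
      using that sab \<rho> by (intro \<rho>2) auto
    have Srho: "\<bar>t - s\<bar> \<le> \<rho>" if t: "t \<in> S" for t
    proof (rule e(2)[OF sab])
      show "t \<in> {a..b}" using t by (simp add: S_def)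
      have "d p (\<gamma> t) < r" using t by (simp add: S_def dball_def)
      then show "d (\<gamma> s) (\<gamma> t) < e" using sp r d_triangle[of "\<gamma> s" "\<gamma> t" p] d_sym[of p "\<gamma> s"] by linarith
    qed
    have mem: "P t - P s \<in> vsec y R" if t: "t \<in> S" for t
    proof -
      have tab: "t \<in> {a..b}" and tp: "d p (\<gamma> t) < r" using t by (auto simp: S_def dball_def)
      define h where "h = \<bar>t - s\<bar>"
      have h: "0 \<le> h" "h \<le> \<rho>" using Srho[OF t] by (auto simp: h_def)
      have \<omega>h: "h * \<omega> h \<le> h * \<eta>"
        using h \<rho>1(2)[of h] \<rho> by (cases "h = 0") (auto intro!: mult_left_mono)
      define T where "T = P t - P s"
      define w where "w = hmul (hinv (\<gamma> s)) (\<gamma> t)"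
      obtain \<xi> where \<xi>: "min s t \<le> \<xi>" "\<xi> \<le> max s t" "T = (t - s) * \<theta> \<xi>"
        unfolding T_def by (rule mean_value[OF P]) blast
      have "\<bar>\<theta> s - \<theta> \<xi>\<bar> \<le> \<kappa> / 2" using \<xi> tab sab h by (intro near) (auto simp: h_def)
      then have "\<kappa> / 2 \<le> \<bar>\<theta> \<xi>\<bar>" using \<theta>s by linarith
      then have "h * (\<kappa> / 2) \<le> \<bar>T\<bar>" using h unfolding \<xi>(3) abs_mult h_def by (intro mult_left_mono) auto
      moreover have "\<bar>vert w - T\<bar> \<le> h * (\<kappa> / 4)"
      proof -
        have "\<bar>vert w - T\<bar> \<le> h * \<omega> h" using vertical[OF sab tab] by (simp add: w_def T_def h_def)
        also have "\<dots> \<le> h * (\<kappa> / 4)" using \<omega>h h \<eta> mult_left_mono[of \<eta> "\<kappa>/4" h] by linarith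
        finally show ?thesis .
      qed
      moreover have "\<bar>vert w\<bar> \<le> 4 * K * r\<^sup>2"
      proof -
        have "N w = d (\<gamma> s) (\<gamma> t)" by (simp add: w_def d_eq_N)
        then have "N w \<le> 2 * r" using sp tp d_triangle[of "\<gamma> s" "\<gamma> t" p] d_sym[of p "\<gamma> s"] by linarith
        then have "(N w)\<^sup>2 \<le> (2 * r)\<^sup>2" by (intro power_mono) auto
        then have "K * (N w)\<^sup>2 \<le> K * (2 * r)\<^sup>2" using K by (intro mult_left_mono) auto
        then show ?thesis using K(2)[of w] by (simp add: power_mult_distrib)
      qed
      moreover have "\<bar>T\<bar> \<le> \<bar>vert w\<bar> + \<bar>vert w - T\<bar>" by linarith
      ultimately have "h * (\<kappa> / 2) \<le> 4 * K * r\<^sup>2 + h * (\<kappa> / 4)" by linarith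
      then have "h * \<kappa> \<le> 16 * K * r\<^sup>2" by (simp add: field_simps)
      then have hr: "h \<le> 16 * K * r\<^sup>2 / \<kappa>" using \<kappa> by (simp add: field_simps)
      have "(C * sqrt (h * \<omega> h))\<^sup>2 = C\<^sup>2 * (h * \<omega> h)"
        using h \<omega>_nonneg[of h] by (simp add: power_mult_distrib)
      also have "\<dots> \<le> C\<^sup>2 * ((16 * K * r\<^sup>2 / \<kappa>) * (\<kappa>^3 / (16 * K * C\<^sup>2)))"
      proof (rule mult_left_mono)
        have "h * \<omega> h \<le> h * \<eta>" by (rule \<omega>h)
        also have "\<dots> \<le> (16 * K * r\<^sup>2 / \<kappa>) * (\<kappa>^3 / (16 * K * C\<^sup>2))"
          using hr \<eta> h K r \<kappa> by (intro mult_mono) auto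
        finally show "h * \<omega> h \<le> \<dots>" .
      qed simp
      also have "\<dots> = (\<kappa> * r)\<^sup>2"
        using C K \<kappa> by (simp add: power2_eq_square power3_eq_cube)
      finally have err: "C * sqrt (h * \<omega> h) \<le> \<kappa> * r"
        by (rule power2_le_imp_le) (use \<kappa> r in simp)
      have "d (\<gamma> t) (hmul (\<gamma> s) (0, 0, T)) \<le> C * sqrt (h * \<omega> h)"
        using C(2)[OF sab tab] by (simp add: T_def h_def)
      then have "d p (hmul (\<gamma> s) (0, 0, T)) < R"
        using err tp d_triangle[of p "hmul (\<gamma> s) (0, 0, T)" "\<gamma> t"] by (simp add: R_def algebra_simps)
      moreover have "d p (hmul (\<gamma> s) (0, 0, T)) = d y (0, 0, T)"
        using d_left[of "\<gamma> s" y "(0, 0, T)"] by (simp add: y_def)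
      ultimately show ?thesis by (simp add: vsec_def dball_def T_def)
    qed
    have "S = {a..b} \<inter> {t. \<kappa> \<le> \<bar>\<theta> t\<bar>} \<inter> ({a..b} \<inter> \<gamma> -` dball d p r)" by (auto simp: S_def)
    also have "\<dots> \<in> sets borel" using open_dball by (intro sets.Int \<gamma>_vimage_borel) measurable
    finally have Smeas: "S \<in> sets borel" .
    have "emeasure \<nu> S \<le> emeasure lborel (vsec y R)"
      unfolding \<nu>_def
    proof (rule emeasure_density_le_monotone_image[OF P \<theta> _ _ Smeas])
      show "(\<forall>x\<in>{u..v}. 0 \<le> \<theta> x) \<or> (\<forall>x\<in>{u..v}. \<theta> x \<le> 0)"
      proof -
        have "\<bar>\<theta> s - \<theta> x\<bar> \<le> \<kappa> / 2" if "x \<in> {u..v}" for x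
          using that by (intro near) (auto simp: u_def v_def)
        then show ?thesis using \<theta>s \<kappa> by (cases "\<theta> s \<ge> 0") (force simp: abs_if split: if_splits)+
      qed
      show "S \<subseteq> {u..v}" using Srho by (force simp: u_def v_def S_def abs_le_iff)
    qed (use mem in auto)
    also have "\<dots> \<le> ennreal (R\<^sup>2) * beta_d d"
    proof (rule emeasure_vsec_le[OF R(1)])
      have "d 0 y = d (\<gamma> s) p" using d_left[of "\<gamma> s" 0 y] by (simp add: y_def)
      then show "d 0 y \<le> R" using sp R d_sym[of p "\<gamma> s"] by linarith
    qed
    also have "\<dots> = ennreal ((1 + \<kappa>)\<^sup>2 * (\<beta> * r\<^sup>2))"
      using \<beta>_pos by (simp add: beta_d_\<beta> R_def power_mult_distrib ennreal_mult[symmetric] mult.commute mult.left_commute)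
    finally show ?thesis by (simp add: S_def)
  next
    case True
    show ?thesis unfolding True by simp
  qed
  then show ?thesis using that[of "e / 2"] e(1) by auto
qed

text \<open>\<open>ball_mass\<close> holds up to a scale e depending only on \<kappa>, and the
  premeasure at that scale is at most \<open>sph2\<close>, so a cover of cost below x + \<kappa>
  exists at exactly this scale; summing the masses of its balls bounds \<nu>.\<close>

lemma sph2_lower:
  assumes A: "A \<in> sets borel" "A \<subseteq> {a..b}"
  shows "emeasure \<nu> A \<le> sph2 d (\<gamma> ` A)"
proof (cases "sph2 d (\<gamma> ` A) = \<infinity>")
  case fin: False
  define x where "x = enn2real (sph2 d (\<gamma> ` A))"
  have x: "sph2 d (\<gamma> ` A) = ennreal x" "x \<ge> 0" using fin by (simp_all add: x_def less_top)
  let ?f = "\<lambda>\<kappa>. \<kappa> * (b - a) + (1 + \<kappa>)\<^sup>2 * (x + \<kappa>)"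
  have bound: "emeasure \<nu> A \<le> ennreal (?f \<kappa>)" if \<kappa>: "\<kappa> > 0" for \<kappa>
  proof -
    obtain e where e: "e > 0" "\<And>p r. 0 < r \<Longrightarrow> r \<le> e \<Longrightarrow>
      emeasure \<nu> {t \<in> {a..b}. \<kappa> \<le> \<bar>\<theta> t\<bar> \<and> \<gamma> t \<in> dball d p r} \<le> ennreal ((1 + \<kappa>)\<^sup>2 * (\<beta> * r\<^sup>2))"
      by (rule ball_mass[OF \<kappa>]) blast
    have "sph_eps d e (\<gamma> ` A) \<le> ennreal x" using sph_eps_le_sph2[OF e(1), of "\<gamma> ` A"] x(1) by simp
    also have "\<dots> < ennreal (x + \<kappa>)" using x \<kappa> by (simp add: ennreal_less_iff)
    finally obtain p r where r: "\<And>i::nat. 0 < r i \<and> r i \<le> e"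
      and cover: "\<gamma> ` A \<subseteq> (\<Union>i. dball d (p i) (r i))"
      and cost: "(\<Sum>i. ennreal (\<beta> * (r i)\<^sup>2)) < ennreal (x + \<kappa>)"
      by (rule sph_eps_lessE) blast
    define S where "S i = {t \<in> {a..b}. \<kappa> \<le> \<bar>\<theta> t\<bar> \<and> \<gamma> t \<in> dball d (p i) (r i)}" for i
    have "S i = {a..b} \<inter> {t. \<kappa> \<le> \<bar>\<theta> t\<bar>} \<inter> ({a..b} \<inter> \<gamma> -` dball d (p i) (r i))" for i by (auto simp: S_def)
    moreover have "{a..b} \<inter> {t. \<kappa> \<le> \<bar>\<theta> t\<bar>} \<inter> ({a..b} \<inter> \<gamma> -` dball d (p i) (r i)) \<in> sets borel" for i
      using open_dball by (intro sets.Int \<gamma>_vimage_borel) measurable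
    ultimately have Smeas: "S i \<in> sets borel" for i by simp
    \<comment> \<open>The parameters about which \<open>ball_mass\<close> says nothing; the density
      is below \<kappa> on them.\<close>
    define A0 where "A0 = {t \<in> {a..b}. \<bar>\<theta> t\<bar> < \<kappa>}"
    have "A0 = {a..b} \<inter> {t. \<bar>\<theta> t\<bar> < \<kappa>}" by (auto simp: A0_def)
    then have A0: "A0 \<in> sets borel" by simp
    have A0le: "emeasure \<nu> A0 \<le> ennreal (\<kappa> * (b - a))"
    proof -
      have "emeasure \<nu> A0 = (\<integral>\<^sup>+t. ennreal \<bar>\<theta> t\<bar> * indicator A0 t \<partial>lborel)"
        unfolding \<nu>_def using A0 by (intro emeasure_density) auto
      also have "\<dots> \<le> (\<integral>\<^sup>+t. ennreal \<kappa> * indicator {a..b} t \<partial>lborel)"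
        by (intro nn_integral_mono) (auto simp: A0_def indicator_def intro!: ennreal_leI)
      also have "\<dots> = ennreal (\<kappa> * (b - a))" using \<kappa> ab by (simp add: nn_integral_cmult ennreal_mult)
      finally show ?thesis .
    qed
    have "A \<subseteq> A0 \<union> (\<Union>i. S i)"
      using A cover by (fastforce simp: A0_def S_def)
    then have "emeasure \<nu> A \<le> emeasure \<nu> (A0 \<union> (\<Union>i. S i))"
      using A0 Smeas by (intro emeasure_mono) auto
    also have "\<dots> \<le> emeasure \<nu> A0 + emeasure \<nu> (\<Union>i. S i)"
      using A0 Smeas by (intro emeasure_subadditive) auto
    also have "\<dots> \<le> ennreal (\<kappa> * (b - a)) + (\<Sum>i. emeasure \<nu> (S i))"
      using A0le Smeas by (intro add_mono emeasure_subadditive_countably) auto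
    also have "(\<Sum>i. emeasure \<nu> (S i)) \<le> (\<Sum>i. ennreal ((1 + \<kappa>)\<^sup>2) * ennreal (\<beta> * (r i)\<^sup>2))"
      using e(2) r \<beta>_pos unfolding S_def
      by (intro suminf_le allI) (simp_all add: ennreal_mult[symmetric])
    also have "\<dots> = ennreal ((1 + \<kappa>)\<^sup>2) * (\<Sum>i. ennreal (\<beta> * (r i)\<^sup>2))" by simp
    also have "\<dots> \<le> ennreal ((1 + \<kappa>)\<^sup>2) * ennreal (x + \<kappa>)"
      using cost by (intro mult_left_mono) auto
    finally have "emeasure \<nu> A \<le> ennreal (\<kappa> * (b - a)) + ennreal ((1 + \<kappa>)\<^sup>2) * ennreal (x + \<kappa>)"
      by (simp add: add_left_mono)
    also have "\<dots> = ennreal (?f \<kappa>)" using \<kappa> x ab by (simp add: ennreal_mult[symmetric] ennreal_plus[symmetric] del: ennreal_plus)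
    finally show ?thesis .
  qed
  have "(?f \<longlongrightarrow> ?f 0) (at_right 0)" by (intro tendsto_intros)
  then have "((\<lambda>\<kappa>. ennreal (?f \<kappa>)) \<longlongrightarrow> ennreal x) (at_right 0)" by (intro tendsto_ennrealI) simp
  moreover have "eventually (\<lambda>\<kappa>. emeasure \<nu> A \<le> ennreal (?f \<kappa>)) (at_right 0)"
    unfolding eventually_at_filter by (intro always_eventually allI impI bound) simp
  ultimately show ?thesis unfolding x(1) by (rule tendsto_lowerbound) simp
qed simp

end

section \<open>The area formula\<close>

lemma continuous_antiderivative:
  fixes f :: "real \<Rightarrow> real"
  assumes f: "continuous_on UNIV f"
  obtains F where "\<And>t. (F has_real_derivative f t) (at t)"
proof -
  have "((\<lambda>u. LBINT y=0..u. f y) has_real_derivative f t) (at t)" for t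
  proof -
    define c where "c = \<bar>t\<bar> + 1"
    have "((\<lambda>u. LBINT y=0..u. f y) has_vector_derivative f t) (at t within {-c..c})"
      using interval_integral_FTC2[of "-c" 0 c f t] continuous_on_subset[OF f] by (auto simp: c_def zero_ereal_def)
    moreover have "at t within {-c..c} = at t" by (rule at_within_interior) (auto simp: c_def)
    ultimately show ?thesis
      by (simp only: has_real_derivative_iff_has_vector_derivative)
  qed
  then show ?thesis using that by blast
qed

lemma interval_exhaustion:
  fixes I :: "real set"
  assumes "is_interval I"
  obtains a b :: "nat \<Rightarrow> real" where "incseq (\<lambda>n. {a n..b n})" "(\<Union>n. {a n..b n}) = I"
proof (cases "I = {}")
  case True
  then show ?thesis using that[of "\<lambda>_. 1" "\<lambda>_. 0"] by simp
next
  case False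
  \<comment> \<open>A countable subset of \<open>I\<close> reaching arbitrarily far to both sides:
    the rationals in \<open>I\<close>, together with attained end points, which may be irrational.
    Running minima and maxima of an enumeration give the compact intervals.\<close>
  define D where "D = (\<rat> \<inter> I) \<union> ({x \<in> I. \<forall>y\<in>I. x \<le> y} \<union> {x \<in> I. \<forall>y\<in>I. y \<le> x})"
  have single: "countable S" if S: "\<And>x y. x \<in> S \<Longrightarrow> y \<in> S \<Longrightarrow> x = y" for S :: "real set"
  proof -
    have "\<exists>l. S \<subseteq> {l}" using S by (metis singleton_iff subset_iff)
    then obtain l where "S \<subseteq> {l}" ..
    then show ?thesis by (rule countable_subset) simp
  qed
  have "countable {x \<in> I. \<forall>y\<in>I. x \<le> y}" "countable {x \<in> I. \<forall>y\<in>I. y \<le> x}"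
    by (rule single, simp add: order_antisym)+
  then have D: "countable D" "D \<subseteq> I"
    unfolding D_def using countable_rat by auto
  have between: "\<exists>l\<in>D. \<exists>u\<in>D. l \<le> x \<and> x \<le> u" if x: "x \<in> I" for x
  proof -
    have rat: "\<exists>q\<in>D. y < q \<and> q < z" if yz: "y \<in> I" "z \<in> I" "y < z" for y z
    proof -
      obtain q where "q \<in> \<rat>" "y < q" "q < z" using Rats_dense_in_real[OF yz(3)] by blast
      moreover have "q \<in> I" using assms yz calculation unfolding is_interval_1 by (meson less_imp_le)
      ultimately show ?thesis by (auto simp: D_def)
    qed
    have "\<exists>l\<in>D. l \<le> x"
    proof (cases "\<exists>y\<in>I. y < x")
      case True
      then show ?thesis using rat x by (meson less_imp_le)
    next
      case False
      then have "x \<in> D" using x by (auto simp: D_def not_less)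
      then show ?thesis by blast
    qed
    moreover have "\<exists>u\<in>D. x \<le> u"
    proof (cases "\<exists>y\<in>I. x < y")
      case True
      then show ?thesis using rat x by (meson less_imp_le)
    next
      case False
      then have "x \<in> D" using x by (auto simp: D_def not_less)
      then show ?thesis by blast
    qed
    ultimately show ?thesis by blast
  qed
  then have "D \<noteq> {}" using False by blast
  define q where "q = from_nat_into D"
  have q: "range q = D" unfolding q_def using \<open>D \<noteq> {}\<close> D by (simp add: range_from_nat_into)
  define a b where "a n = Min (q ` {..n})" and "b n = Max (q ` {..n})" for n
  have "q ` {..n} \<subseteq> I" for n using q D by blast
  moreover have "a n \<in> q ` {..n}" "b n \<in> q ` {..n}" for n
    unfolding a_def b_def by (intro Min_in Max_in; simp)+
  ultimately have ab: "a n \<in> I" "b n \<in> I" for n by blast+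
  have "incseq (\<lambda>n. {a n..b n})"
  proof (rule incseq_SucI)
    fix n
    have "a (Suc n) \<le> a n" "b n \<le> b (Suc n)"
      unfolding a_def b_def by (auto intro!: Min_antimono Max_mono)
    then show "{a n..b n} \<subseteq> {a (Suc n)..b (Suc n)}" by auto
  qed
  moreover have "(\<Union>n. {a n..b n}) = I"
  proof (intro equalityI subsetI)
    fix x assume "x \<in> (\<Union>n. {a n..b n})"
    then obtain n where "a n \<le> x" "x \<le> b n" by auto
    then show "x \<in> I" by (rule mem_is_interval_1_I[OF assms ab])
  next
    fix x assume "x \<in> I"
    then obtain l u where lu: "l \<in> D" "u \<in> D" "l \<le> x" "x \<le> u" using between by blast
    then obtain i j where ij: "l = q i" "u = q j" using q by blast
    have "a (max i j) \<le> l" "u \<le> b (max i j)" unfolding a_def b_def ij by auto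
    then have "x \<in> {a (max i j)..b (max i j)}" using lu by auto
    then show "x \<in> (\<Union>n. {a n..b n})" by blast
  qed
  ultimately show ?thesis by (rule that)
qed

context homogeneous_distance
begin

text \<open>Serves the degenerate interval a = b, which \<open>vertical_curve\<close> excludes; one
  ball of arbitrarily small radius suffices.\<close>

lemma sph2_singleton: "sph2 d {x} = 0"
proof -
  have "sph2 d {x} \<le> ennreal (\<beta> * r\<^sup>2)" if r: "r > 0" for r
  proof (rule sph2_le)
    fix e :: real assume e: "0 < e"
    have "sph_eps d e {x} \<le> ennreal (\<beta> * (min e r)\<^sup>2)"
      using sph_eps_le_finite[of e 1 "\<lambda>_. min e r" "{x}" "\<lambda>_. x"] e r by (simp add: dball_def lessThan_Suc)
    also have "\<dots> \<le> ennreal (\<beta> * r\<^sup>2)"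
      using e r \<beta>_pos by (auto intro!: ennreal_leI mult_left_mono power_mono)
    finally show "sph_eps d e {x} \<le> ennreal (\<beta> * r\<^sup>2)" .
  qed
  then have "eventually (\<lambda>r. sph2 d {x} \<le> ennreal (\<beta> * r\<^sup>2)) (at_right 0)"
    by (simp add: eventually_at_filter)
  moreover have "((\<lambda>r. \<beta> * r\<^sup>2) \<longlongrightarrow> \<beta> * 0\<^sup>2) (at_right 0)" by (intro tendsto_intros)
  then have "((\<lambda>r. ennreal (\<beta> * r\<^sup>2)) \<longlongrightarrow> 0) (at_right 0)"
    using tendsto_ennrealI by fastforce
  ultimately have "sph2 d {x} \<le> 0" by (intro tendsto_lowerbound[of _ 0 "at_right 0"]) auto
  then show ?thesis by simp
qed

end

lemma (in vertical_curve) sph2_image_eq: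
  assumes U: "U \<in> sets borel"
  shows "sph2 d (\<gamma> ` {a..b} \<inter> U) = emeasure \<nu> ({a..b} \<inter> \<gamma> -` U)"
proof -
  define A B where "A = {a..b} \<inter> \<gamma> -` U" and "B = {a..b} - A"
  have A: "A \<in> sets borel" unfolding A_def by (rule \<gamma>_vimage_borel[OF U])
  then have B: "B \<in> sets borel" by (auto simp: B_def)
  \<comment> \<open>A primitive Q of |\<theta>| links the two sides: Q b - Q a is the bound of
    \<open>sph2_upper\<close> and also the total \<nu>-mass.\<close>
  have "continuous_on UNIV (\<lambda>t. \<bar>\<theta> t\<bar>)" by (intro continuous_intros \<theta>)
  then obtain Q where Q: "\<And>t. (Q has_real_derivative \<bar>\<theta> t\<bar>) (at t)" by (rule continuous_antiderivative) blast
  have "emeasure \<nu> {a..b} = (\<integral>\<^sup>+t. ennreal \<bar>\<theta> t\<bar> * indicator {a..b} t \<partial>lborel)"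
    unfolding \<nu>_def by (intro emeasure_density) auto
  also have "\<dots> = ennreal (Q b - Q a)"
    using ab by (intro nn_integral_FTC_Icc) (auto intro: DERIV_subset[OF Q])
  finally have total: "emeasure \<nu> {a..b} = ennreal (Q b - Q a)" .
  have im: "\<gamma> ` {a..b} \<in> sets borel"
    by (intro borel_compact compact_continuous_image continuous_\<gamma>) simp
  have imA: "\<gamma> ` A = \<gamma> ` {a..b} \<inter> U" and imB: "\<gamma> ` B = \<gamma> ` {a..b} - U" by (auto simp: A_def B_def)
  have "sph2 d (\<gamma> ` A) + sph2 d (\<gamma> ` B) = emeasure (sph2_measure d) (\<gamma> ` A) + emeasure (sph2_measure d) (\<gamma> ` B)"
    using im U by (simp add: emeasure_sph2_measure imA imB)
  also have "\<dots> = emeasure (sph2_measure d) (\<gamma> ` A \<union> \<gamma> ` B)"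
    using im U by (intro plus_emeasure) (auto simp: imA imB)
  also have "\<gamma> ` A \<union> \<gamma> ` B = \<gamma> ` {a..b}" by (auto simp: A_def B_def)
  also have "emeasure (sph2_measure d) (\<gamma> ` {a..b}) = sph2 d (\<gamma> ` {a..b})"
    using im by (rule emeasure_sph2_measure)
  also have "\<dots> \<le> emeasure \<nu> {a..b}" unfolding total by (rule sph2_upper[OF Q])
  also have "\<dots> = emeasure \<nu> A + emeasure \<nu> B"
    using A B by (subst plus_emeasure) (auto simp: A_def B_def intro!: arg_cong[where f = "emeasure \<nu>"])
  finally have le: "sph2 d (\<gamma> ` A) + sph2 d (\<gamma> ` B) \<le> emeasure \<nu> A + emeasure \<nu> B" .
  have "sph2 d (\<gamma> ` A) + emeasure \<nu> B \<le> sph2 d (\<gamma> ` A) + sph2 d (\<gamma> ` B)"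
    using B by (intro add_left_mono sph2_lower) (auto simp: B_def)
  also note le
  finally have "emeasure \<nu> B + sph2 d (\<gamma> ` A) \<le> emeasure \<nu> B + emeasure \<nu> A" by (simp add: add.commute)
  \<comment> \<open>Finiteness of the total mass allows \<nu>(B) to be cancelled in extended
    nonnegative reals.\<close>
  moreover have "emeasure \<nu> B \<le> emeasure \<nu> {a..b}" by (rule emeasure_mono) (auto simp: B_def)
  then have "emeasure \<nu> B \<noteq> \<infinity>" by (auto simp: total top_unique)
  ultimately have "sph2 d (\<gamma> ` A) \<le> emeasure \<nu> A" by (simp add: ennreal_add_left_cancel_le)
  moreover have "emeasure \<nu> A \<le> sph2 d (\<gamma> ` A)" by (rule sph2_lower[OF A]) (auto simp: A_def)
  ultimately show ?thesis unfolding imA[symmetric] A_def[symmetric] by (rule antisym)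
qed

context homogeneous_distance
begin

text \<open>Translates interval integrals into the primitive required by
  \<open>vertical_curve\<close> and adds the empty and one-point intervals. Continuity is exported
  because Borel measurability of images and preimages depends on it.\<close>

lemma sph2_image_compact_interval:
  fixes \<gamma> :: "real \<Rightarrow> heis" and \<theta> \<omega> :: "real \<Rightarrow> real"
  assumes inj: "inj_on \<gamma> {a..b}" and cont: "continuous_on {a..b} \<theta>"
    and \<omega>_nonneg: "\<And>t. 0 \<le> t \<Longrightarrow> 0 \<le> \<omega> t"
    and \<omega>_mono: "\<And>s t. 0 \<le> s \<Longrightarrow> s \<le> t \<Longrightarrow> \<omega> s \<le> \<omega> t"
    and \<omega>_lim: "(\<omega> \<longlongrightarrow> 0) (at_right 0)"
    and horiz: "\<And>s t. s \<in> {a..b} \<Longrightarrow> t \<in> {a..b} \<Longrightarrow>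
        hnorm (hmul (hinv (\<gamma> s)) (\<gamma> t)) \<le> sqrt (\<bar>t - s\<bar> * \<omega> \<bar>t - s\<bar>)"
    and vertical: "\<And>s t. s \<in> {a..b} \<Longrightarrow> t \<in> {a..b} \<Longrightarrow>
        \<bar>vert (hmul (hinv (\<gamma> s)) (\<gamma> t)) - (LBINT \<tau>=s..t. \<theta> \<tau>)\<bar> \<le> \<bar>t - s\<bar> * \<omega> \<bar>t - s\<bar>"
  shows "continuous_on {a..b} \<gamma>"
    and "U \<in> sets borel \<Longrightarrow> sph2 d (\<gamma> ` {a..b} \<inter> U) =
      (\<integral>\<^sup>+t. ennreal \<bar>\<theta> t\<bar> * indicator ({a..b} \<inter> \<gamma> -` U) t \<partial>lborel)"
proof -
  have "continuous_on {a..b} \<gamma> \<and> (U \<in> sets borel \<longrightarrow> sph2 d (\<gamma> ` {a..b} \<inter> U) =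
      (\<integral>\<^sup>+t. ennreal \<bar>\<theta> t\<bar> * indicator ({a..b} \<inter> \<gamma> -` U) t \<partial>lborel))"
  proof (cases a b rule: linorder_cases)
    case greater
    then show ?thesis using sph2_le[of "{}" 0] by simp
  next
    case equal
    have "sph2 d ({\<gamma> b} \<inter> U) \<le> sph2 d {\<gamma> b}" by (rule sph2_mono) auto
    then have "sph2 d ({\<gamma> b} \<inter> U) = 0" by (simp add: sph2_singleton)
    moreover have "AE t in lborel. ennreal \<bar>\<theta> t\<bar> * indicator ({b} \<inter> \<gamma> -` U) t = 0"
      using AE_lborel_singleton[of b] by eventually_elim (simp add: indicator_def)
    from nn_integral_cong_AE[OF this]
    have "(\<integral>\<^sup>+t. ennreal \<bar>\<theta> t\<bar> * indicator ({b} \<inter> \<gamma> -` U) t \<partial>lborel) = 0" by simp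
    ultimately show ?thesis using equal by simp
  next
    case less
    \<comment> \<open>Clamping the argument extends \<theta> continuously to the line by its
      boundary values.\<close>
    define \<theta>' where "\<theta>' t = \<theta> (max a (min b t))" for t
    have \<theta>': "continuous_on UNIV \<theta>'" unfolding \<theta>'_def
      using less by (intro continuous_on_compose2[OF cont] continuous_intros) auto
    have eq: "\<theta>' t = \<theta> t" if "t \<in> {a..b}" for t using that by (simp add: \<theta>'_def)
    obtain P where P: "\<And>t. (P has_real_derivative \<theta>' t) (at t)" using continuous_antiderivative[OF \<theta>'] by blast
    have integral: "(LBINT \<tau>=s..t. \<theta> \<tau>) = P t - P s" if st: "s \<in> {a..b}" "t \<in> {a..b}" for s t
    proof (rule interval_integral_FTC_finite)
      show "continuous_on {min s t..max s t} \<theta>"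
        using st by (intro continuous_on_subset[OF cont]) auto
      fix x assume "min s t \<le> x" "x \<le> max s t"
      then have "x \<in> {a..b}" using st by auto
      then show "(P has_vector_derivative \<theta> x) (at x within {min s t..max s t})"
        using P[of x] by (simp add: eq has_real_derivative_iff_has_vector_derivative
          has_vector_derivative_at_within)
    qed
    interpret vertical_curve d \<gamma> P \<theta>' \<omega> a b
      by unfold_locales (use less inj P \<theta>' \<omega>_nonneg \<omega>_mono \<omega>_lim horiz vertical integral in auto)
    have "sph2 d (\<gamma> ` {a..b} \<inter> U) =
        (\<integral>\<^sup>+t. ennreal \<bar>\<theta> t\<bar> * indicator ({a..b} \<inter> \<gamma> -` U) t \<partial>lborel)" if U: "U \<in> sets borel"
    proof -
      have "sph2 d (\<gamma> ` {a..b} \<inter> U) = emeasure \<nu> ({a..b} \<inter> \<gamma> -` U)" by (rule sph2_image_eq[OF U])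
      also have "\<dots> = (\<integral>\<^sup>+t. ennreal \<bar>\<theta>' t\<bar> * indicator ({a..b} \<inter> \<gamma> -` U) t \<partial>lborel)"
        unfolding \<nu>_def using \<gamma>_vimage_borel[OF U] by (intro emeasure_density) auto
      also have "\<dots> = (\<integral>\<^sup>+t. ennreal \<bar>\<theta> t\<bar> * indicator ({a..b} \<inter> \<gamma> -` U) t \<partial>lborel)"
        by (intro nn_integral_cong) (auto simp: indicator_def eq)
      finally show ?thesis .
    qed
    then show ?thesis using continuous_\<gamma> by simp
  qed
  then show "continuous_on {a..b} \<gamma>"
    and "U \<in> sets borel \<Longrightarrow> sph2 d (\<gamma> ` {a..b} \<inter> U) =
      (\<integral>\<^sup>+t. ennreal \<bar>\<theta> t\<bar> * indicator ({a..b} \<inter> \<gamma> -` U) t \<partial>lborel)" by blast+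
qed

end

theorem mainTheorem10:
  fixes d :: "heis \<Rightarrow> heis \<Rightarrow> real"
    and I :: "real set"
    and \<gamma> :: "real \<Rightarrow> heis"
    and \<theta> :: "real \<Rightarrow> real"
    and \<omega> :: "real \<Rightarrow> real"
  assumes d: "heis_dist d"
    and I: "is_interval I"
    and inj: "inj_on \<gamma> I"
    and theta_cont: "continuous_on I \<theta>"
    and omega_nonneg: "\<And>t. 0 \<le> t \<Longrightarrow> 0 \<le> \<omega> t"
    and omega_mono: "\<And>s t. 0 \<le> s \<Longrightarrow> s \<le> t \<Longrightarrow> \<omega> s \<le> \<omega> t"
    and omega_lim: "(\<omega> \<longlongrightarrow> 0) (at_right 0)"
    and horiz: "\<And>s t. s \<in> I \<Longrightarrow> t \<in> I \<Longrightarrow>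
        hnorm (hmul (hinv (\<gamma> s)) (\<gamma> t)) \<le> sqrt (\<bar>t - s\<bar> * \<omega> \<bar>t - s\<bar>)"
    and vertical: "\<And>s t. s \<in> I \<Longrightarrow> t \<in> I \<Longrightarrow>
        \<bar>vert (hmul (hinv (\<gamma> s)) (\<gamma> t)) - (LBINT \<tau>=s..t. \<theta> \<tau>)\<bar> \<le> \<bar>t - s\<bar> * \<omega> \<bar>t - s\<bar>"
  shows "(\<forall>U \<in> sets borel.
            sph2 d (\<gamma> ` I \<inter> U) =
            emeasure (distr (density (restrict_space lborel I) (\<lambda>\<tau>. ennreal \<bar>\<theta> \<tau>\<bar>)) borel \<gamma>) U)
       \<and> (\<forall>u :: heis \<Rightarrow> real. u \<in> borel_measurable borel \<longrightarrow> bounded (range u) \<longrightarrow>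
            (LINT x:(\<gamma> ` I)|sph2_measure d. u x) = (LINT \<tau>:I|lborel. u (\<gamma> \<tau>) * \<bar>\<theta> \<tau>\<bar>))"
proof -
  interpret homogeneous_distance d by unfold_locales (rule d)
  obtain a b :: "nat \<Rightarrow> real" where ab: "incseq (\<lambda>n. {a n..b n})" "(\<Union>n. {a n..b n}) = I"
    by (rule interval_exhaustion[OF I]) blast
  define J where "J n = {a n..b n}" for n
  have J: "incseq J" "(\<Union>n. J n) = I" using ab by (simp_all add: J_def[abs_def])
  have JI: "J n \<subseteq> I" for n using J by blast
  have memI: "t \<in> I" if "t \<in> {a n..b n}" for t n using that JI[of n] by (auto simp: J_def)
  have piece: "continuous_on (J n) \<gamma>" "U \<in> sets borel \<Longrightarrow> sph2 d (\<gamma> ` J n \<inter> U) =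
      (\<integral>\<^sup>+t. ennreal \<bar>\<theta> t\<bar> * indicator (J n \<inter> \<gamma> -` U) t \<partial>lborel)" for n U
    unfolding J_def
    by (rule sph2_image_compact_interval[where \<theta> = \<theta> and \<omega> = \<omega>],
        use inj_on_subset[OF inj] continuous_on_subset[OF theta_cont] JI memI horiz vertical
          omega_nonneg omega_mono omega_lim in \<open>auto simp: J_def\<close>)+
  have Jborel: "J n \<in> sets borel" for n by (simp add: J_def)
  then have Iborel: "I \<in> sets borel" unfolding J(2)[symmetric] by auto
  have preJ: "J n \<inter> \<gamma> -` U \<in> sets borel" if U: "U \<in> sets borel" for n U
  proof -
    have "\<gamma> \<in> borel_measurable (restrict_space borel (J n))"
      by (intro borel_measurable_continuous_on_restrict piece)
    from measurable_sets[OF this U] show ?thesis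
      using Jborel by (simp add: sets_restrict_space_iff space_restrict_space Int_commute)
  qed
  \<comment> \<open>Measurability on \<open>I\<close> is glued from the compact pieces, on each of
    which \<gamma> is continuous.\<close>
  have preI: "I \<inter> \<gamma> -` U \<in> sets borel" if U: "U \<in> sets borel" for U
  proof -
    have "I \<inter> \<gamma> -` U = (\<Union>n. J n \<inter> \<gamma> -` U)" using J(2) by auto
    moreover have "(\<Union>n. J n \<inter> \<gamma> -` U) \<in> sets borel"
      using preJ[OF U] by (intro sets.countable_UN) auto
    ultimately show ?thesis by simp
  qed
  define R where "R = restrict_space lborel I"
  have Ilborel: "I \<inter> space lborel \<in> sets lborel" using Iborel by simp
  have \<gamma>R: "\<gamma> \<in> measurable R borel"
    using preI Ilborel by (intro measurableI) (auto simp: R_def sets_restrict_space_iff space_restrict_space Int_commute)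
  have "\<theta> \<in> borel_measurable (restrict_space borel I)"
    by (intro borel_measurable_continuous_on_restrict theta_cont)
  then have \<theta>R [measurable]: "\<theta> \<in> borel_measurable R"
    unfolding R_def by (simp cong: measurable_cong_sets sets_restrict_space_cong add: sets_restrict_space)
  define M where "M = distr (density R (\<lambda>\<tau>. ennreal \<bar>\<theta> \<tau>\<bar>)) borel \<gamma>"
  have M: "emeasure M U = (\<integral>\<^sup>+t. ennreal \<bar>\<theta> t\<bar> * indicator (I \<inter> \<gamma> -` U) t \<partial>lborel)" if U: "U \<in> sets borel" for U
  proof -
    have "emeasure M U = emeasure (density R (\<lambda>\<tau>. ennreal \<bar>\<theta> \<tau>\<bar>)) (\<gamma> -` U \<inter> I)"
      unfolding M_def using \<gamma>R U by (subst emeasure_distr) (auto simp: R_def space_restrict_space)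
    also have "\<dots> = (\<integral>\<^sup>+t. ennreal \<bar>\<theta> t\<bar> * indicator (\<gamma> -` U \<inter> I) t \<partial>R)"
    proof (rule emeasure_density)
      show "\<gamma> -` U \<inter> I \<in> sets R"
        using preI[OF U] Ilborel by (simp add: R_def sets_restrict_space_iff Int_commute)
    qed simp
    also have "\<dots> = (\<integral>\<^sup>+t. ennreal \<bar>\<theta> t\<bar> * indicator (\<gamma> -` U \<inter> I) t * indicator I t \<partial>lborel)"
      unfolding R_def using Ilborel by (rule nn_integral_restrict_space)
    also have "\<dots> = (\<integral>\<^sup>+t. ennreal \<bar>\<theta> t\<bar> * indicator (I \<inter> \<gamma> -` U) t \<partial>lborel)"
      by (intro nn_integral_cong) (auto simp: indicator_def)
    finally show ?thesis .
  qed
  have "\<gamma> ` J n \<in> sets borel" for n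
    using piece(1)[of n] by (intro borel_compact compact_continuous_image) (auto simp: J_def)
  note imJ = this
  have imI: "\<gamma> ` I \<in> sets borel"
    unfolding J(2)[symmetric] image_UN using imJ by auto
  have main: "sph2 d (\<gamma> ` I \<inter> U) = emeasure M U" if U: "U \<in> sets borel" for U
  proof -
    \<comment> \<open>Continuity from below for both measures along these sets; the spherical side
      uses that \<open>sph2\<close> is a measure on Borel sets.\<close>
    define V where "V n = \<gamma> ` J n \<inter> U" for n
    have V: "V n \<in> sets borel" for n using imJ U by (simp add: V_def)
    have Vinc: "incseq V" using J(1) unfolding V_def incseq_def by blast
    have VUn: "(\<Union>n. V n) = \<gamma> ` I \<inter> U" unfolding V_def J(2)[symmetric] by blast
    have "emeasure (sph2_measure d) (V n) = emeasure M (V n)" for n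
    proof -
      \<comment> \<open>By injectivity no parameter of \<open>I\<close> outside \<open>J n\<close>
        is mapped into \<gamma>(J n), so the push-forward of V n involves only
        \<open>J n\<close>.\<close>
      have "I \<inter> \<gamma> -` V n = J n \<inter> \<gamma> -` U"
        using JI[of n] inj_on_image_mem_iff[OF inj _ JI[of n]] unfolding V_def by blast
      then show ?thesis using M[OF V] piece(2)[OF U, of n] emeasure_sph2_measure[OF V] by (simp add: V_def)
    qed
    then have "(SUP n. emeasure (sph2_measure d) (V n)) = (SUP n. emeasure M (V n))" by simp
    then have "emeasure (sph2_measure d) (\<gamma> ` I \<inter> U) = emeasure M (\<gamma> ` I \<inter> U)"
      using V Vinc by (subst (asm) (1 2) SUP_emeasure_incseq) (auto simp: VUn M_def)
    moreover have "emeasure M (\<gamma> ` I \<inter> U) = emeasure M U"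
    proof -
      have "I \<inter> \<gamma> -` (\<gamma> ` I \<inter> U) = I \<inter> \<gamma> -` U" by auto
      moreover have "\<gamma> ` I \<inter> U \<in> sets borel" using imI U by simp
      ultimately show ?thesis by (simp only: M U)
    qed
    ultimately show ?thesis using emeasure_sph2_measure[of "\<gamma> ` I \<inter> U"] imI U by simp
  qed
  \<comment> \<open>The spherical measure restricted to \<gamma>(I), written as a density so that
    the set integral over \<gamma>(I) becomes an integral against \<open>M\<close>; the
    push-forward, density and restriction in \<open>M\<close> then unfold in turn.\<close>
  have restr: "density (sph2_measure d) (\<lambda>x. ennreal (indicator (\<gamma> ` I) x)) = M"
  proof (rule measure_eqI)
    fix U assume "U \<in> sets (density (sph2_measure d) (\<lambda>x. ennreal (indicator (\<gamma> ` I) x)))"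
    then have U: "U \<in> sets borel" by simp
    show "emeasure (density (sph2_measure d) (\<lambda>x. ennreal (indicator (\<gamma> ` I) x))) U = emeasure M U"
      using U imI main[OF U] emeasure_sph2_measure[of "\<gamma> ` I \<inter> U"]
      by (simp add: ennreal_indicator emeasure_restricted)
  qed (simp add: M_def)
  have "(LINT x:(\<gamma> ` I)|sph2_measure d. u x) = (LINT \<tau>:I|lborel. u (\<gamma> \<tau>) * \<bar>\<theta> \<tau>\<bar>)"
    if u: "u \<in> borel_measurable borel" for u :: "heis \<Rightarrow> real"
  proof -
    have "(LINT x:(\<gamma> ` I)|sph2_measure d. u x) = integral\<^sup>L M u"
      unfolding set_lebesgue_integral_def restr[symmetric] using u imI
      by (intro integral_density[symmetric]) auto
    also have "\<dots> = (LINT \<tau>|density R (\<lambda>\<tau>. ennreal \<bar>\<theta> \<tau>\<bar>). u (\<gamma> \<tau>))"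
      unfolding M_def using u \<gamma>R by (intro integral_distr) auto
    also have "\<dots> = (LINT \<tau>|R. \<bar>\<theta> \<tau>\<bar> *\<^sub>R u (\<gamma> \<tau>))"
      using measurable_compose[OF \<gamma>R u] by (intro integral_density) auto
    also have "\<dots> = (LINT \<tau>:I|lborel. \<bar>\<theta> \<tau>\<bar> *\<^sub>R u (\<gamma> \<tau>))"
      unfolding R_def set_lebesgue_integral_def using Ilborel by (rule integral_restrict_space)
    finally show ?thesis by (simp add: mult.commute)
  qed
  then show ?thesis using main unfolding M_def R_def by blast
qed

end
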